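(* Let $H$ be an alternative bialgebra and let $A$ be an alternative algebra and an alternative coalgebra in the category ${}^{H}_{H}\mathcal{M}{}^{H}_{H}$ of alternative Hopf bimodules over $H$, with structure maps $\triangleright:H\otimes A\to A$, $\triangleleft:A\otimes H\to A$, $\phi:A\to H\otimes A$, $\psi:A\to A\otimes H$. On $E=A\oplus H$ define, for $a,b\in A$, $x,y\in H$, $$(a+x)(b+y)=ab+x\triangleright b+a\triangleleft y+xy,\qquad \Delta_E(a+x)=\Delta_A(a)+\phi(a)+\psi(a)+\Delta_H(x).$$ Then $E$ with this multiplication and comultiplication is an alternative bialgebra if and only if $A$ is a braided alternative bialgebra in ${}^{H}_{H}\mathcal{M}{}^{H}_{H}$.
   Context: All vector spaces are over a fixed field of characteristic zero. $\tau(u\otimes v)=v\otimes u$, $\tau_{12}(u\otimes v\otimes w)=v\otimes u\otimes w$, $\tau_{23}(u\otimes v\otimes w)=u\otimes w\otimes v$. An alternative algebra is a vector space with a bilinear multiplication such that $(ab)c-a(bc)+(ba)c-b(ac)=0$ and $(ab)c-a(bc)+(ac)b-a(cb)=0$. An alternative coalgebra is a vector space with a linear map $\Delta(a)=a_1\otimes a_2$ such that $D:=(\Delta\otimes\mathrm{id})\Delta-(\mathrm{id}\otimes\Delta)\Delta$ satisfies $D=-\tau_{12}D$ and $D=-\tau_{23}D$. An alternative bialgebra is an alternative algebra which is also an alternative coalgebra such that $\Delta(ab)=a_1b\otimes a_2+a_2b\otimes a_1-a_2\otimes ba_1+b_1\otimes ab_2+b_1\otimes b_2a-ab_1\otimes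 b_2$ and $\Delta(ba)+\tau\Delta(ba)=a_1\otimes ba_2+ba_2\otimes a_1+b_1a\otimes b_2+b_2\otimes b_1a$. Let $H$ be an alternative bialgebra and $V$ a vector space with linear maps $\triangleright:H\otimes V\to V$, $\triangleleft:V\otimes H\to V$, $\phi:V\to H\otimes V$, $\phi(v)=v_{(-1)}\otimes v_{(0)}$, $\psi:V\to V\otimes H$, $\psi(v)=v_{(0)}\otimes v_{(1)}$. Below $x,y\in H$, $v\in V$. $V$ is an $H$-bimodule if $(xy)\triangleright v-x\triangleright(y\triangleright v)+(yx)\triangleright v-y\triangleright(x\triangleright v)=0$; $v\triangleleft(xy)-(v\triangleleft x)\triangleleft y+x\triangleright(v\triangleleft y)-(x\triangleright v)\triangleleft y=0$; $(xy)\triangleright v-x\triangleright(y\triangleright v)+(x\triangleright v)\triangleleft y-x\triangleright(v\triangleleft y)=0$; $(v\triangleleft x)\triangleleft y-v\triangleleft(xy)+(v\triangleleft y)\triangleleft x-v\triangleleft(yx)=0$. $V$ is an $H$-bicomodule if, with $D_1=(\Delta_H\otimes\mathrm{id})\phi-(\mathrm{id}\otimes\phi)\phi$, $D_2=(\phi\otimes\mathrm{id})\psi-(\mathrm{id}\otimes\psi)\phi$, $D_3=(\psi\otimes\mathrm{id})\psi-(\mathrm{id}\otimes\Delta_H)\psi$, one has $D_1=-\tau_{12}D_1$, $D_3=-\tau_{12}D_2$, $D_1=-\tau_{23}D_2$, $D_3=-\tau_{23}D_3$. $V$ is an alternative Hopf bimodule over $H$ if it is an $H$-bimodule and $H$-bicomodule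 and (HM1) $\phi(x\triangleright v)=v_{(-1)}\otimes(x\triangleright v_{(0)})+v_{(-1)}\otimes(v_{(0)}\triangleleft x)-x_2\otimes(v\triangleleft x_1)-xv_{(-1)}\otimes v_{(0)}$; (HM2) $\psi(v\triangleleft x)=(v_{(0)}\triangleleft x)\otimes v_{(1)}+(v_{(0)}\triangleleft x)\otimes v_{(-1)}-v_{(0)}\otimes xv_{(-1)}-(v\triangleleft x_1)\otimes x_2$; (HM3) $\psi(x\triangleright v)=(x_1\triangleright v)\otimes x_2+(x_2\triangleright v)\otimes x_1+v_{(0)}\otimes xv_{(1)}+v_{(0)}\otimes v_{(1)}x-(x\triangleright v_{(0)})\otimes v_{(1)}$; (HM4) $\phi(v\triangleleft x)=v_{(-1)}x\otimes v_{(0)}+v_{(1)}x\otimes v_{(0)}-v_{(1)}\otimes(x\triangleright v_{(0)})+x_1\otimes(v\triangleleft x_2)+x_1\otimes(x_2\triangleright v)$; (HM5) $\phi(x\triangleright v)+\tau\psi(x\triangleright v)=v_{(-1)}\otimes(x\triangleright v_{(0)})+xv_{(1)}\otimes v_{(0)}+x_2\otimes(x_1\triangleright v)$; (HM6) $\phi(v\triangleleft x)+\tau\psi(v\triangleleft x)=x_1\otimes(v\triangleleft x_2)+v_{(-1)}x\otimes v_{(0)}+v_{(1)}\otimes(v_{(0)}\triangleleft x)$. $A$ is an alternative algebra and an alternative coalgebra in ${}^{H}_{H}\mathcal{M}{}^{H}_{H}$ if $A$ is an alternative algebra, an alternative coalgebra, an alternative Hopf bimodule over $H$, and for all $a,b\in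 A$, $x\in H$: ($H$-bimodule alternative algebra) $(a\triangleleft x)b-a(x\triangleright b)+(x\triangleright a)b-x\triangleright(ab)=0$; $(ab)\triangleleft x-a(b\triangleleft x)+(ba)\triangleleft x-b(a\triangleleft x)=0$; $(x\triangleright a)b-x\triangleright(ab)+(x\triangleright b)a-x\triangleright(ba)=0$; $(a\triangleleft x)b-a(x\triangleright b)+(ab)\triangleleft x-a(b\triangleleft x)=0$. ($H$-bicomodule alternative coalgebra) with $F_1=(\phi\otimes\mathrm{id})\Delta_A-(\mathrm{id}\otimes\Delta_A)\phi$, $F_2=(\psi\otimes\mathrm{id})\Delta_A-(\mathrm{id}\otimes\phi)\Delta_A$, $F_3=(\Delta_A\otimes\mathrm{id})\psi-(\mathrm{id}\otimes\psi)\Delta_A$: $F_1=-\tau_{12}F_2$, $F_3=-\tau_{12}F_3$, $F_1=-\tau_{23}F_1$, $F_3=-\tau_{23}F_2$. ($H$-bimodule alternative coalgebra) $\Delta_A(x\triangleright b)=b_1\otimes(x\triangleright b_2)+b_1\otimes(b_2\triangleleft x)-(x\triangleright b_1)\otimes b_2$; $\Delta_A(a\triangleleft x)=(a_1\triangleleft x)\otimes a_2+(a_2\triangleleft x)\otimes a_1-a_2\otimes(x\triangleright a_1)$; $\Delta_A(x\triangleright a)+\tau\Delta_A(x\triangleright a)=a_1\otimes(x\triangleright a_2)+(x\triangleright a_2)\otimes a_1$; $\Delta_A(b\triangleleft x)+\tau\Delta_A(b\triangleleft x)=b_2\otimes(b_1\triangleleft x)+(b_1\triangleleft x)\otimes b_2$.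 ($H$-bicomodule alternative algebra) $\phi(ab)=b_{(-1)}\otimes ab_{(0)}+b_{(-1)}\otimes b_{(0)}a-a_{(1)}\otimes ba_{(0)}$; $\psi(ab)=a_{(0)}b\otimes a_{(1)}+a_{(0)}b\otimes a_{(-1)}-ab_{(0)}\otimes b_{(1)}$; $\phi(ba)+\tau\psi(ba)=a_{(-1)}\otimes ba_{(0)}+b_{(1)}\otimes b_{(0)}a$; $\psi(ba)+\tau\phi(ba)=ba_{(0)}\otimes a_{(-1)}+b_{(0)}a\otimes b_{(1)}$. Such an $A$ is a braided alternative bialgebra in ${}^{H}_{H}\mathcal{M}{}^{H}_{H}$ if moreover for all $a,b\in A$: (BB1) $\Delta_A(ab)=a_1b\otimes a_2+a_2b\otimes a_1-a_2\otimes ba_1+b_1\otimes ab_2+b_1\otimes b_2a-ab_1\otimes b_2+(a_{(-1)}\triangleright b)\otimes a_{(0)}+(a_{(1)}\triangleright b)\otimes a_{(0)}-a_{(0)}\otimes(b\triangleleft a_{(-1)})+b_{(0)}\otimes(a\triangleleft b_{(1)})+b_{(0)}\otimes(b_{(1)}\triangleright a)-(a\triangleleft b_{(-1)})\otimes b_{(0)}$; (BB2) $\Delta_A(ba)+\tau\Delta_A(ba)=a_1\otimes ba_2+ba_2\otimes a_1+b_1a\otimes b_2+b_2\otimes b_1a+a_{(0)}\otimes(b\triangleleft a_{(1)})+(b\triangleleft a_{(1)})\otimes a_{(0)}+b_{(0)}\otimes(b_{(-1)}\triangleright a)+(b_{(-1)}\triangleright a)\otimes b_{(0)}$. *)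

theory Defs
  imports "HOL-Analysis.Product_Vector" "HOL-Library.Poly_Mapping"
begin

text \<open>
  A vector space is a type of sort \<open>ab_group_add\<close> with a scalar multiplication satisfying
  the library locale \<open>vector_space\<close>; the ground field is a type \<open>'k\<close> of sort \<open>field_char_0\<close>.

  The tensor product \<open>U \<otimes> V\<close> is the quotient of the free vector space on \<open>U \<times> V\<close>, i.e. of
  \<open>'u \<times> 'v \<Rightarrow>\<^sub>0 'k\<close>, by the span of the bilinearity relations; its elements are cosets.
  \<open>U \<otimes> V \<otimes> W\<close> is likewise the quotient of the free vector space on \<open>U \<times> V \<times> W\<close> by the
  trilinearity relations, which makes the usual identification
  \<open>(U \<otimes> V) \<otimes> W = U \<otimes> (V \<otimes> W)\<close> implicit.
\<close>

section \<open>Tensor products\<close>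

definition formal_scale :: "'k::field \<Rightarrow> ('x \<Rightarrow>\<^sub>0 'k) \<Rightarrow> ('x \<Rightarrow>\<^sub>0 'k)" where
  "formal_scale c t = Poly_Mapping.map ((*) c) t"

lemma lookup_formal_scale [simp]:
  "Poly_Mapping.lookup (formal_scale c t) x = c * Poly_Mapping.lookup t x"
  by (simp add: formal_scale_def Poly_Mapping.map.rep_eq when_def)

interpretation formal: vector_space formal_scale
  by unfold_locales (auto intro!: poly_mapping_eqI simp: lookup_add algebra_simps)

definition formal_extend :: "('x \<Rightarrow> ('y \<Rightarrow>\<^sub>0 'k::field)) \<Rightarrow> ('x \<Rightarrow>\<^sub>0 'k) \<Rightarrow> ('y \<Rightarrow>\<^sub>0 'k)" where
  "formal_extend f t =
     (\<Sum>x \<in> Poly_Mapping.keys t. formal_scale (Poly_Mapping.lookup t x) (f x))"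

definition pure2 :: "'u \<Rightarrow> 'v \<Rightarrow> ('u \<times> 'v \<Rightarrow>\<^sub>0 'k::field)" (infix "\<otimes>" 68) where
  "u \<otimes> v = Poly_Mapping.single (u, v) 1"

definition pure3 :: "'u \<Rightarrow> 'v \<Rightarrow> 'w \<Rightarrow> ('u \<times> 'v \<times> 'w \<Rightarrow>\<^sub>0 'k::field)" where
  "pure3 u v w = Poly_Mapping.single (u, v, w) 1"

definition tensor_null ::
  "('k::field \<Rightarrow> 'u::ab_group_add \<Rightarrow> 'u) \<Rightarrow> ('k \<Rightarrow> 'v::ab_group_add \<Rightarrow> 'v) \<Rightarrow> ('u \<times> 'v \<Rightarrow>\<^sub>0 'k) set" where
  "tensor_null s1 s2 = module.span formal_scale
     ({(u + u') \<otimes> v - u \<otimes> v - u' \<otimes> v | u u' v. True} \<union>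
      {u \<otimes> (v + v') - u \<otimes> v - u \<otimes> v' | u v v'. True} \<union>
      {s1 c u \<otimes> v - formal_scale c (u \<otimes> v) | c u v. True} \<union>
      {u \<otimes> s2 c v - formal_scale c (u \<otimes> v) | c u v. True})"

definition tensor_null3 ::
  "('k::field \<Rightarrow> 'u::ab_group_add \<Rightarrow> 'u) \<Rightarrow> ('k \<Rightarrow> 'v::ab_group_add \<Rightarrow> 'v) \<Rightarrow>
   ('k \<Rightarrow> 'w::ab_group_add \<Rightarrow> 'w) \<Rightarrow> ('u \<times> 'v \<times> 'w \<Rightarrow>\<^sub>0 'k) set" where
  "tensor_null3 s1 s2 s3 = module.span formal_scale
     ({pure3 (u + u') v w - pure3 u v w - pure3 u' v w | u u' v w. True} \<union>
      {pure3 u (v + v') w - pure3 u v w - pure3 u v' w | u v v' w. True} \<union>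
      {pure3 u v (w + w') - pure3 u v w - pure3 u v w' | u v w w'. True} \<union>
      {pure3 (s1 c u) v w - formal_scale c (pure3 u v w) | c u v w. True} \<union>
      {pure3 u (s2 c v) w - formal_scale c (pure3 u v w) | c u v w. True} \<union>
      {pure3 u v (s3 c w) - formal_scale c (pure3 u v w) | c u v w. True})"

definition tensor_class ::
  "('k::field \<Rightarrow> 'u::ab_group_add \<Rightarrow> 'u) \<Rightarrow> ('k \<Rightarrow> 'v::ab_group_add \<Rightarrow> 'v) \<Rightarrow>
   ('u \<times> 'v \<Rightarrow>\<^sub>0 'k) \<Rightarrow> ('u \<times> 'v \<Rightarrow>\<^sub>0 'k) set" where
  "tensor_class s1 s2 t = {t'. t' - t \<in> tensor_null s1 s2}"

definition tensor_class3 ::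
  "('k::field \<Rightarrow> 'u::ab_group_add \<Rightarrow> 'u) \<Rightarrow> ('k \<Rightarrow> 'v::ab_group_add \<Rightarrow> 'v) \<Rightarrow>
   ('k \<Rightarrow> 'w::ab_group_add \<Rightarrow> 'w) \<Rightarrow> ('u \<times> 'v \<times> 'w \<Rightarrow>\<^sub>0 'k) \<Rightarrow> ('u \<times> 'v \<times> 'w \<Rightarrow>\<^sub>0 'k) set" where
  "tensor_class3 s1 s2 s3 t = {t'. t' - t \<in> tensor_null3 s1 s2 s3}"

definition tensor_space ::
  "('k::field \<Rightarrow> 'u::ab_group_add \<Rightarrow> 'u) \<Rightarrow> ('k \<Rightarrow> 'v::ab_group_add \<Rightarrow> 'v) \<Rightarrow>
   ('u \<times> 'v \<Rightarrow>\<^sub>0 'k) set set" where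
  "tensor_space s1 s2 = range (tensor_class s1 s2)"

text \<open>Linear maps \<open>f : V \<rightarrow> U\<^sub>1 \<otimes> U\<^sub>2\<close>; the vector space operations of the quotient are those
  induced on representatives.\<close>

definition linear_to_tensor ::
  "('k::field \<Rightarrow> 'v::ab_group_add \<Rightarrow> 'v) \<Rightarrow> ('k \<Rightarrow> 'p::ab_group_add \<Rightarrow> 'p) \<Rightarrow>
   ('k \<Rightarrow> 'q::ab_group_add \<Rightarrow> 'q) \<Rightarrow> ('v \<Rightarrow> ('p \<times> 'q \<Rightarrow>\<^sub>0 'k) set) \<Rightarrow> bool" where
  "linear_to_tensor s s1 s2 f \<longleftrightarrow>
     (\<forall>v. f v \<in> tensor_space s1 s2) \<and>
     (\<forall>v w. \<forall>t \<in> f v. \<forall>t' \<in> f w. t + t' \<in> f (v + w)) \<and>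
     (\<forall>c v. \<forall>t \<in> f v. formal_scale c t \<in> f (s c v))"

definition bilinear_map ::
  "('k::field \<Rightarrow> 'u::ab_group_add \<Rightarrow> 'u) \<Rightarrow> ('k \<Rightarrow> 'v::ab_group_add \<Rightarrow> 'v) \<Rightarrow>
   ('k \<Rightarrow> 'w::ab_group_add \<Rightarrow> 'w) \<Rightarrow> ('u \<Rightarrow> 'v \<Rightarrow> 'w) \<Rightarrow> bool" where
  "bilinear_map s1 s2 s3 f \<longleftrightarrow>
     (\<forall>u. Vector_Spaces.linear s2 s3 (f u)) \<and> (\<forall>v. Vector_Spaces.linear s1 s3 (\<lambda>u. f u v))"

text \<open>
  Sweedler notation: if \<open>\<Delta> a = a\<^sub>1 \<otimes> a\<^sub>2\<close> (sum over a representative understood), then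
  \<open>sw (\<Delta> a) (\<lambda>a\<^sub>1 a\<^sub>2. f a\<^sub>1 a\<^sub>2)\<close> is the corresponding sum of the \<open>f a\<^sub>1 a\<^sub>2\<close>.
  It is a formal sum, used only up to \<open>tensor_class\<close> or \<open>tensor_class3\<close>. When \<open>f\<close> is bilinear
  up to the relations, its class does not depend on the representative: lemma
  \<open>formal_extend_well_defined\<close> below.
\<close>

definition sw :: "('u \<times> 'v \<Rightarrow>\<^sub>0 'k::field) set \<Rightarrow> ('u \<Rightarrow> 'v \<Rightarrow> ('y \<Rightarrow>\<^sub>0 'k)) \<Rightarrow> ('y \<Rightarrow>\<^sub>0 'k)" where
  "sw T f = formal_extend (\<lambda>(u, v). f u v) (SOME t. t \<in> T)"

lemma formal_extend_superset:
  assumes "finite S" "Poly_Mapping.keys t \<subseteq> S"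
  shows "formal_extend f t = (\<Sum>x\<in>S. formal_scale (Poly_Mapping.lookup t x) (f x))"
  unfolding formal_extend_def
  by (rule sum.mono_neutral_left) (use assms in \<open>auto simp: in_keys_iff\<close>)

lemma formal_extend_linear:
  fixes f :: "'x \<Rightarrow> ('y \<Rightarrow>\<^sub>0 'k::field)"
  shows "Vector_Spaces.linear formal_scale formal_scale (formal_extend f)"
proof unfold_locales
  fix s t :: "'x \<Rightarrow>\<^sub>0 'k"
  let ?S = "Poly_Mapping.keys s \<union> Poly_Mapping.keys t"
  have "formal_extend f (s + t) =
      (\<Sum>x\<in>?S. formal_scale (Poly_Mapping.lookup (s + t) x) (f x))"
    by (rule formal_extend_superset) (auto dest: set_mp[OF Poly_Mapping.keys_add])
  also have "\<dots> = formal_extend f s + formal_extend f t"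
    by (simp add: formal_extend_superset[of ?S] lookup_add formal.scale_left_distrib sum.distrib)
  finally show "formal_extend f (s + t) = formal_extend f s + formal_extend f t" .
next
  fix c :: 'k and t :: "'x \<Rightarrow>\<^sub>0 'k"
  have "formal_extend f (formal_scale c t) =
      (\<Sum>x\<in>Poly_Mapping.keys t.
        formal_scale (Poly_Mapping.lookup (formal_scale c t) x) (f x))"
    by (rule formal_extend_superset) (auto simp: in_keys_iff)
  then show "formal_extend f (formal_scale c t) = formal_scale c (formal_extend f t)"
    by (simp add: formal_extend_def formal.scale_sum_right)
qed

lemma formal_extend_single [simp]: "formal_extend f (Poly_Mapping.single x 1) = f x"
  by (simp add: formal_extend_def)

lemma formal_extend_well_defined:
  fixes s1 :: "'k::field \<Rightarrow> 'u::ab_group_add \<Rightarrow> 'u" and s2 :: "'k \<Rightarrow> 'v::ab_group_add \<Rightarrow> 'v"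
    and f :: "'u \<Rightarrow> 'v \<Rightarrow> ('y \<Rightarrow>\<^sub>0 'k)"
  assumes N: "formal.subspace N"
    and "\<And>u u' v. f (u + u') v - f u v - f u' v \<in> N"
    and "\<And>u v v'. f u (v + v') - f u v - f u v' \<in> N"
    and "\<And>c u v. f (s1 c u) v - formal_scale c (f u v) \<in> N"
    and "\<And>c u v. f u (s2 c v) - formal_scale c (f u v) \<in> N"
    and "t' \<in> tensor_class s1 s2 t"
  shows "formal_extend (\<lambda>(u, v). f u v) t' - formal_extend (\<lambda>(u, v). f u v) t \<in> N"
proof -
  let ?F = "formal_extend (\<lambda>(u, v). f u v)"
  interpret F: Vector_Spaces.linear formal_scale formal_scale ?F
    by (rule formal_extend_linear)
  have "t' - t \<in> tensor_null s1 s2"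
    using assms(6) by (simp add: tensor_class_def)
  then have "?F (t' - t) \<in> N"
    unfolding tensor_null_def
  proof (induction rule: formal.span_induct)
    case base
    show ?case
      using F.subspace_vimage[OF N] by (simp add: vimage_def)
  next
    case (step t)
    then show ?case
      using assms(2-5) by (auto simp: F.diff F.scale pure2_def)
  qed
  then show ?thesis
    by (simp add: F.diff)
qed

definition flip :: "('u \<times> 'v \<Rightarrow>\<^sub>0 'k::field) \<Rightarrow> ('v \<times> 'u \<Rightarrow>\<^sub>0 'k)" where
  "flip = formal_extend (\<lambda>(u, v). v \<otimes> u)"

definition flip12 :: "('u \<times> 'v \<times> 'w \<Rightarrow>\<^sub>0 'k::field) \<Rightarrow> ('v \<times> 'u \<times> 'w \<Rightarrow>\<^sub>0 'k)" where
  "flip12 = formal_extend (\<lambda>(u, v, w). pure3 v u w)"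

definition flip23 :: "('u \<times> 'v \<times> 'w \<Rightarrow>\<^sub>0 'k::field) \<Rightarrow> ('u \<times> 'w \<times> 'v \<Rightarrow>\<^sub>0 'k)" where
  "flip23 = formal_extend (\<lambda>(u, v, w). pure3 u w v)"

text \<open>\<open>(f \<otimes> id) T\<close> and \<open>(id \<otimes> f) T\<close> for \<open>T \<in> U \<otimes> V\<close>, and \<open>T\<close> itself, as formal sums.\<close>

definition tensor_id :: "('u \<Rightarrow> ('p \<times> 'q \<Rightarrow>\<^sub>0 'k::field) set) \<Rightarrow> ('u \<times> 'v \<Rightarrow>\<^sub>0 'k) set \<Rightarrow>
    ('p \<times> 'q \<times> 'v \<Rightarrow>\<^sub>0 'k)" where
  "tensor_id f T = sw T (\<lambda>u v. sw (f u) (\<lambda>p q. pure3 p q v))"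

definition id_tensor :: "('v \<Rightarrow> ('p \<times> 'q \<Rightarrow>\<^sub>0 'k::field) set) \<Rightarrow> ('u \<times> 'v \<Rightarrow>\<^sub>0 'k) set \<Rightarrow>
    ('u \<times> 'p \<times> 'q \<Rightarrow>\<^sub>0 'k)" where
  "id_tensor f T = sw T (\<lambda>u v. sw (f v) (\<lambda>p q. pure3 u p q))"

definition formal_rep :: "('u \<times> 'v \<Rightarrow>\<^sub>0 'k::field) set \<Rightarrow> ('u \<times> 'v \<Rightarrow>\<^sub>0 'k)" where
  "formal_rep T = sw T (\<lambda>u v. u \<otimes> v)"


section \<open>Alternative algebras, coalgebras and bialgebras\<close>

locale alternative_algebra = vector_space scale
  for scale :: "'k::field_char_0 \<Rightarrow> 'a::ab_group_add \<Rightarrow> 'a" +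
  fixes mult :: "'a \<Rightarrow> 'a \<Rightarrow> 'a" (infixl "\<cdot>" 70)
  assumes mult_bilinear: "bilinear_map scale scale scale mult"
    and left_alternative: "(a \<cdot> b) \<cdot> c - a \<cdot> (b \<cdot> c) + (b \<cdot> a) \<cdot> c - b \<cdot> (a \<cdot> c) = 0"
    and right_alternative: "(a \<cdot> b) \<cdot> c - a \<cdot> (b \<cdot> c) + (a \<cdot> c) \<cdot> b - a \<cdot> (c \<cdot> b) = 0"

definition coassociator :: "('a \<Rightarrow> ('a \<times> 'a \<Rightarrow>\<^sub>0 'k::field) set) \<Rightarrow> 'a \<Rightarrow> ('a \<times> 'a \<times> 'a \<Rightarrow>\<^sub>0 'k)" where
  "coassociator \<Delta> a = tensor_id \<Delta> (\<Delta> a) - id_tensor \<Delta> (\<Delta> a)"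

locale alternative_coalgebra = vector_space scale
  for scale :: "'k::field_char_0 \<Rightarrow> 'a::ab_group_add \<Rightarrow> 'a" +
  fixes comult :: "'a \<Rightarrow> ('a \<times> 'a \<Rightarrow>\<^sub>0 'k) set" ("\<Delta>")
  assumes comult_linear: "linear_to_tensor scale scale scale \<Delta>"
    and coalternative12:
      "tensor_class3 scale scale scale (coassociator \<Delta> a) =
       tensor_class3 scale scale scale (- flip12 (coassociator \<Delta> a))"
    and coalternative23:
      "tensor_class3 scale scale scale (coassociator \<Delta> a) =
       tensor_class3 scale scale scale (- flip23 (coassociator \<Delta> a))"

locale alternative_bialgebra =
  alternative_algebra scale mult + alternative_coalgebra scale comult
  for scale :: "'k::field_char_0 \<Rightarrow> 'a::ab_group_add \<Rightarrow> 'a"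
    and mult :: "'a \<Rightarrow> 'a \<Rightarrow> 'a" (infixl "\<cdot>" 70)
    and comult :: "'a \<Rightarrow> ('a \<times> 'a \<Rightarrow>\<^sub>0 'k) set" ("\<Delta>") +
  assumes comult_mult:
      "\<Delta> (a \<cdot> b) = tensor_class scale scale
        (sw (\<Delta> a) (\<lambda>a1 a2. (a1 \<cdot> b) \<otimes> a2) + sw (\<Delta> a) (\<lambda>a1 a2. (a2 \<cdot> b) \<otimes> a1)
         - sw (\<Delta> a) (\<lambda>a1 a2. a2 \<otimes> (b \<cdot> a1)) + sw (\<Delta> b) (\<lambda>b1 b2. b1 \<otimes> (a \<cdot> b2))
         + sw (\<Delta> b) (\<lambda>b1 b2. b1 \<otimes> (b2 \<cdot> a)) - sw (\<Delta> b) (\<lambda>b1 b2. (a \<cdot> b1) \<otimes> b2))"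
    and comult_mult_sym:
      "tensor_class scale scale (formal_rep (\<Delta> (b \<cdot> a)) + flip (formal_rep (\<Delta> (b \<cdot> a)))) =
       tensor_class scale scale
        (sw (\<Delta> a) (\<lambda>a1 a2. a1 \<otimes> (b \<cdot> a2)) + sw (\<Delta> a) (\<lambda>a1 a2. (b \<cdot> a2) \<otimes> a1)
         + sw (\<Delta> b) (\<lambda>b1 b2. (b1 \<cdot> a) \<otimes> b2) + sw (\<Delta> b) (\<lambda>b1 b2. b2 \<otimes> (b1 \<cdot> a)))"


section \<open>Alternative Hopf bimodules\<close>

locale alternative_bimodule =
  H: alternative_algebra scaleH multH + V: vector_space scaleV
  for scaleH :: "'k::field_char_0 \<Rightarrow> 'h::ab_group_add \<Rightarrow> 'h"
    and multH :: "'h \<Rightarrow> 'h \<Rightarrow> 'h" (infixl "\<cdot>\<^sub>H" 70)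
    and scaleV :: "'k \<Rightarrow> 'v::ab_group_add \<Rightarrow> 'v" +
  fixes lact :: "'h \<Rightarrow> 'v \<Rightarrow> 'v" (infixr "\<rhd>" 70)
    and ract :: "'v \<Rightarrow> 'h \<Rightarrow> 'v" (infixl "\<lhd>" 70)
  assumes lact_bilinear: "bilinear_map scaleH scaleV scaleV lact"
    and ract_bilinear: "bilinear_map scaleV scaleH scaleV ract"
    and bimodule1: "(x \<cdot>\<^sub>H y) \<rhd> v - x \<rhd> (y \<rhd> v) + (y \<cdot>\<^sub>H x) \<rhd> v - y \<rhd> (x \<rhd> v) = 0"
    and bimodule2: "v \<lhd> (x \<cdot>\<^sub>H y) - (v \<lhd> x) \<lhd> y + x \<rhd> (v \<lhd> y) - (x \<rhd> v) \<lhd> y = 0"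
    and bimodule3: "(x \<cdot>\<^sub>H y) \<rhd> v - x \<rhd> (y \<rhd> v) + (x \<rhd> v) \<lhd> y - x \<rhd> (v \<lhd> y) = 0"
    and bimodule4: "(v \<lhd> x) \<lhd> y - v \<lhd> (x \<cdot>\<^sub>H y) + (v \<lhd> y) \<lhd> x - v \<lhd> (y \<cdot>\<^sub>H x) = 0"

definition bicomodule_D1 where
  "bicomodule_D1 \<Delta>\<^sub>H \<phi> v = tensor_id \<Delta>\<^sub>H (\<phi> v) - id_tensor \<phi> (\<phi> v)"
definition bicomodule_D2 where
  "bicomodule_D2 \<phi> \<psi> v = tensor_id \<phi> (\<psi> v) - id_tensor \<psi> (\<phi> v)"
definition bicomodule_D3 where
  "bicomodule_D3 \<Delta>\<^sub>H \<psi> v = tensor_id \<psi> (\<psi> v) - id_tensor \<Delta>\<^sub>H (\<psi> v)"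

locale alternative_bicomodule =
  H: alternative_coalgebra scaleH comultH + V: vector_space scaleV
  for scaleH :: "'k::field_char_0 \<Rightarrow> 'h::ab_group_add \<Rightarrow> 'h"
    and comultH :: "'h \<Rightarrow> ('h \<times> 'h \<Rightarrow>\<^sub>0 'k) set" ("\<Delta>\<^sub>H")
    and scaleV :: "'k \<Rightarrow> 'v::ab_group_add \<Rightarrow> 'v" +
  fixes lcoact :: "'v \<Rightarrow> ('h \<times> 'v \<Rightarrow>\<^sub>0 'k) set" ("\<phi>")
    and rcoact :: "'v \<Rightarrow> ('v \<times> 'h \<Rightarrow>\<^sub>0 'k) set" ("\<psi>")
  assumes lcoact_linear: "linear_to_tensor scaleV scaleH scaleV \<phi>"
    and rcoact_linear: "linear_to_tensor scaleV scaleV scaleH \<psi>"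
    and bicomodule1:
      "tensor_class3 scaleH scaleH scaleV (bicomodule_D1 \<Delta>\<^sub>H \<phi> v) =
       tensor_class3 scaleH scaleH scaleV (- flip12 (bicomodule_D1 \<Delta>\<^sub>H \<phi> v))"
    and bicomodule2:
      "tensor_class3 scaleV scaleH scaleH (bicomodule_D3 \<Delta>\<^sub>H \<psi> v) =
       tensor_class3 scaleV scaleH scaleH (- flip12 (bicomodule_D2 \<phi> \<psi> v))"
    and bicomodule3:
      "tensor_class3 scaleH scaleH scaleV (bicomodule_D1 \<Delta>\<^sub>H \<phi> v) =
       tensor_class3 scaleH scaleH scaleV (- flip23 (bicomodule_D2 \<phi> \<psi> v))"
    and bicomodule4:
      "tensor_class3 scaleV scaleH scaleH (bicomodule_D3 \<Delta>\<^sub>H \<psi> v) =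
       tensor_class3 scaleV scaleH scaleH (- flip23 (bicomodule_D3 \<Delta>\<^sub>H \<psi> v))"

text \<open>Below, \<open>vm1\<close>, \<open>v0\<close>, \<open>v1\<close> stand for \<open>v\<^bsub>(-1)\<^esub>\<close>, \<open>v\<^bsub>(0)\<^esub>\<close>, \<open>v\<^bsub>(1)\<^esub>\<close>.\<close>

locale alternative_Hopf_bimodule =
  H: alternative_bialgebra scaleH multH comultH +
  alternative_bimodule scaleH multH scaleV lact ract +
  alternative_bicomodule scaleH comultH scaleV lcoact rcoact
  for scaleH :: "'k::field_char_0 \<Rightarrow> 'h::ab_group_add \<Rightarrow> 'h"
    and multH :: "'h \<Rightarrow> 'h \<Rightarrow> 'h" (infixl "\<cdot>\<^sub>H" 70)
    and comultH :: "'h \<Rightarrow> ('h \<times> 'h \<Rightarrow>\<^sub>0 'k) set" ("\<Delta>\<^sub>H")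
    and scaleV :: "'k \<Rightarrow> 'v::ab_group_add \<Rightarrow> 'v"
    and lact :: "'h \<Rightarrow> 'v \<Rightarrow> 'v" (infixr "\<rhd>" 70)
    and ract :: "'v \<Rightarrow> 'h \<Rightarrow> 'v" (infixl "\<lhd>" 70)
    and lcoact :: "'v \<Rightarrow> ('h \<times> 'v \<Rightarrow>\<^sub>0 'k) set" ("\<phi>")
    and rcoact :: "'v \<Rightarrow> ('v \<times> 'h \<Rightarrow>\<^sub>0 'k) set" ("\<psi>") +
  assumes HM1:
      "\<phi> (x \<rhd> v) = tensor_class scaleH scaleV
        (sw (\<phi> v) (\<lambda>vm1 v0. vm1 \<otimes> (x \<rhd> v0)) + sw (\<phi> v) (\<lambda>vm1 v0. vm1 \<otimes> (v0 \<lhd> x))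
         - sw (\<Delta>\<^sub>H x) (\<lambda>x1 x2. x2 \<otimes> (v \<lhd> x1)) - sw (\<phi> v) (\<lambda>vm1 v0. (x \<cdot>\<^sub>H vm1) \<otimes> v0))"
    and HM2:
      "\<psi> (v \<lhd> x) = tensor_class scaleV scaleH
        (sw (\<psi> v) (\<lambda>v0 v1. (v0 \<lhd> x) \<otimes> v1) + sw (\<phi> v) (\<lambda>vm1 v0. (v0 \<lhd> x) \<otimes> vm1)
         - sw (\<phi> v) (\<lambda>vm1 v0. v0 \<otimes> (x \<cdot>\<^sub>H vm1)) - sw (\<Delta>\<^sub>H x) (\<lambda>x1 x2. (v \<lhd> x1) \<otimes> x2))"
    and HM3:
      "\<psi> (x \<rhd> v) = tensor_class scaleV scaleH
        (sw (\<Delta>\<^sub>H x) (\<lambda>x1 x2. (x1 \<rhd> v) \<otimes> x2) + sw (\<Delta>\<^sub>H x) (\<lambda>x1 x2. (x2 \<rhd> v) \<otimes> x1)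
         + sw (\<psi> v) (\<lambda>v0 v1. v0 \<otimes> (x \<cdot>\<^sub>H v1)) + sw (\<psi> v) (\<lambda>v0 v1. v0 \<otimes> (v1 \<cdot>\<^sub>H x))
         - sw (\<psi> v) (\<lambda>v0 v1. (x \<rhd> v0) \<otimes> v1))"
    and HM4:
      "\<phi> (v \<lhd> x) = tensor_class scaleH scaleV
        (sw (\<phi> v) (\<lambda>vm1 v0. (vm1 \<cdot>\<^sub>H x) \<otimes> v0) + sw (\<psi> v) (\<lambda>v0 v1. (v1 \<cdot>\<^sub>H x) \<otimes> v0)
         - sw (\<psi> v) (\<lambda>v0 v1. v1 \<otimes> (x \<rhd> v0))
         + sw (\<Delta>\<^sub>H x) (\<lambda>x1 x2. x1 \<otimes> (v \<lhd> x2)) + sw (\<Delta>\<^sub>H x) (\<lambda>x1 x2. x1 \<otimes> (x2 \<rhd> v)))"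
    and HM5:
      "tensor_class scaleH scaleV (formal_rep (\<phi> (x \<rhd> v)) + flip (formal_rep (\<psi> (x \<rhd> v)))) =
       tensor_class scaleH scaleV
        (sw (\<phi> v) (\<lambda>vm1 v0. vm1 \<otimes> (x \<rhd> v0)) + sw (\<psi> v) (\<lambda>v0 v1. (x \<cdot>\<^sub>H v1) \<otimes> v0)
         + sw (\<Delta>\<^sub>H x) (\<lambda>x1 x2. x2 \<otimes> (x1 \<rhd> v)))"
    and HM6:
      "tensor_class scaleH scaleV (formal_rep (\<phi> (v \<lhd> x)) + flip (formal_rep (\<psi> (v \<lhd> x)))) =
       tensor_class scaleH scaleV
        (sw (\<Delta>\<^sub>H x) (\<lambda>x1 x2. x1 \<otimes> (v \<lhd> x2)) + sw (\<phi> v) (\<lambda>vm1 v0. (vm1 \<cdot>\<^sub>H x) \<otimes> v0)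
         + sw (\<psi> v) (\<lambda>v0 v1. v1 \<otimes> (v0 \<lhd> x)))"


section \<open>Algebras and coalgebras in the category of alternative Hopf bimodules\<close>

definition bicomodule_F1 where
  "bicomodule_F1 \<Delta>\<^sub>A \<phi> a = tensor_id \<phi> (\<Delta>\<^sub>A a) - id_tensor \<Delta>\<^sub>A (\<phi> a)"
definition bicomodule_F2 where
  "bicomodule_F2 \<Delta>\<^sub>A \<phi> \<psi> a = tensor_id \<psi> (\<Delta>\<^sub>A a) - id_tensor \<phi> (\<Delta>\<^sub>A a)"
definition bicomodule_F3 where
  "bicomodule_F3 \<Delta>\<^sub>A \<psi> a = tensor_id \<Delta>\<^sub>A (\<psi> a) - id_tensor \<psi> (\<Delta>\<^sub>A a)"

locale Hopf_bimodule_algebra_coalgebra =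
  alternative_Hopf_bimodule scaleH multH comultH scaleA lact ract lcoact rcoact +
  A: alternative_algebra scaleA multA +
  A: alternative_coalgebra scaleA comultA
  for scaleH :: "'k::field_char_0 \<Rightarrow> 'h::ab_group_add \<Rightarrow> 'h"
    and multH :: "'h \<Rightarrow> 'h \<Rightarrow> 'h" (infixl "\<cdot>\<^sub>H" 70)
    and comultH :: "'h \<Rightarrow> ('h \<times> 'h \<Rightarrow>\<^sub>0 'k) set" ("\<Delta>\<^sub>H")
    and scaleA :: "'k \<Rightarrow> 'a::ab_group_add \<Rightarrow> 'a"
    and multA :: "'a \<Rightarrow> 'a \<Rightarrow> 'a" (infixl "\<cdot>" 70)
    and comultA :: "'a \<Rightarrow> ('a \<times> 'a \<Rightarrow>\<^sub>0 'k) set" ("\<Delta>\<^sub>A")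
    and lact :: "'h \<Rightarrow> 'a \<Rightarrow> 'a" (infixr "\<rhd>" 70)
    and ract :: "'a \<Rightarrow> 'h \<Rightarrow> 'a" (infixl "\<lhd>" 70)
    and lcoact :: "'a \<Rightarrow> ('h \<times> 'a \<Rightarrow>\<^sub>0 'k) set" ("\<phi>")
    and rcoact :: "'a \<Rightarrow> ('a \<times> 'h \<Rightarrow>\<^sub>0 'k) set" ("\<psi>") +
  assumes bimodule_algebra1: "(a \<lhd> x) \<cdot> b - a \<cdot> (x \<rhd> b) + (x \<rhd> a) \<cdot> b - x \<rhd> (a \<cdot> b) = 0"
    and bimodule_algebra2: "(a \<cdot> b) \<lhd> x - a \<cdot> (b \<lhd> x) + (b \<cdot> a) \<lhd> x - b \<cdot> (a \<lhd> x) = 0"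
    and bimodule_algebra3: "(x \<rhd> a) \<cdot> b - x \<rhd> (a \<cdot> b) + (x \<rhd> b) \<cdot> a - x \<rhd> (b \<cdot> a) = 0"
    and bimodule_algebra4: "(a \<lhd> x) \<cdot> b - a \<cdot> (x \<rhd> b) + (a \<cdot> b) \<lhd> x - a \<cdot> (b \<lhd> x) = 0"
    and bicomodule_coalgebra1:
      "tensor_class3 scaleH scaleA scaleA (bicomodule_F1 \<Delta>\<^sub>A \<phi> a) =
       tensor_class3 scaleH scaleA scaleA (- flip12 (bicomodule_F2 \<Delta>\<^sub>A \<phi> \<psi> a))"
    and bicomodule_coalgebra2:
      "tensor_class3 scaleA scaleA scaleH (bicomodule_F3 \<Delta>\<^sub>A \<psi> a) =
       tensor_class3 scaleA scaleA scaleH (- flip12 (bicomodule_F3 \<Delta>\<^sub>A \<psi> a))"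
    and bicomodule_coalgebra3:
      "tensor_class3 scaleH scaleA scaleA (bicomodule_F1 \<Delta>\<^sub>A \<phi> a) =
       tensor_class3 scaleH scaleA scaleA (- flip23 (bicomodule_F1 \<Delta>\<^sub>A \<phi> a))"
    and bicomodule_coalgebra4:
      "tensor_class3 scaleA scaleA scaleH (bicomodule_F3 \<Delta>\<^sub>A \<psi> a) =
       tensor_class3 scaleA scaleA scaleH (- flip23 (bicomodule_F2 \<Delta>\<^sub>A \<phi> \<psi> a))"
    and bimodule_coalgebra1:
      "\<Delta>\<^sub>A (x \<rhd> b) = tensor_class scaleA scaleA
        (sw (\<Delta>\<^sub>A b) (\<lambda>b1 b2. b1 \<otimes> (x \<rhd> b2)) + sw (\<Delta>\<^sub>A b) (\<lambda>b1 b2. b1 \<otimes> (b2 \<lhd> x))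
         - sw (\<Delta>\<^sub>A b) (\<lambda>b1 b2. (x \<rhd> b1) \<otimes> b2))"
    and bimodule_coalgebra2:
      "\<Delta>\<^sub>A (a \<lhd> x) = tensor_class scaleA scaleA
        (sw (\<Delta>\<^sub>A a) (\<lambda>a1 a2. (a1 \<lhd> x) \<otimes> a2) + sw (\<Delta>\<^sub>A a) (\<lambda>a1 a2. (a2 \<lhd> x) \<otimes> a1)
         - sw (\<Delta>\<^sub>A a) (\<lambda>a1 a2. a2 \<otimes> (x \<rhd> a1)))"
    and bimodule_coalgebra3:
      "tensor_class scaleA scaleA
         (formal_rep (\<Delta>\<^sub>A (x \<rhd> a)) + flip (formal_rep (\<Delta>\<^sub>A (x \<rhd> a)))) =
       tensor_class scaleA scaleA
        (sw (\<Delta>\<^sub>A a) (\<lambda>a1 a2. a1 \<otimes> (x \<rhd> a2)) + sw (\<Delta>\<^sub>A a) (\<lambda>a1 a2. (x \<rhd> a2) \<otimes> a1))"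
    and bimodule_coalgebra4:
      "tensor_class scaleA scaleA
         (formal_rep (\<Delta>\<^sub>A (b \<lhd> x)) + flip (formal_rep (\<Delta>\<^sub>A (b \<lhd> x)))) =
       tensor_class scaleA scaleA
        (sw (\<Delta>\<^sub>A b) (\<lambda>b1 b2. b2 \<otimes> (b1 \<lhd> x)) + sw (\<Delta>\<^sub>A b) (\<lambda>b1 b2. (b1 \<lhd> x) \<otimes> b2))"
    and bicomodule_algebra1:
      "\<phi> (a \<cdot> b) = tensor_class scaleH scaleA
        (sw (\<phi> b) (\<lambda>bm1 b0. bm1 \<otimes> (a \<cdot> b0)) + sw (\<phi> b) (\<lambda>bm1 b0. bm1 \<otimes> (b0 \<cdot> a))
         - sw (\<psi> a) (\<lambda>a0 a1. a1 \<otimes> (b \<cdot> a0)))"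
    and bicomodule_algebra2:
      "\<psi> (a \<cdot> b) = tensor_class scaleA scaleH
        (sw (\<psi> a) (\<lambda>a0 a1. (a0 \<cdot> b) \<otimes> a1) + sw (\<phi> a) (\<lambda>am1 a0. (a0 \<cdot> b) \<otimes> am1)
         - sw (\<psi> b) (\<lambda>b0 b1. (a \<cdot> b0) \<otimes> b1))"
    and bicomodule_algebra3:
      "tensor_class scaleH scaleA (formal_rep (\<phi> (b \<cdot> a)) + flip (formal_rep (\<psi> (b \<cdot> a)))) =
       tensor_class scaleH scaleA
        (sw (\<phi> a) (\<lambda>am1 a0. am1 \<otimes> (b \<cdot> a0)) + sw (\<psi> b) (\<lambda>b0 b1. b1 \<otimes> (b0 \<cdot> a)))"
    and bicomodule_algebra4:
      "tensor_class scaleA scaleH (formal_rep (\<psi> (b \<cdot> a)) + flip (formal_rep (\<phi> (b \<cdot> a)))) =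
       tensor_class scaleA scaleH
        (sw (\<phi> a) (\<lambda>am1 a0. (b \<cdot> a0) \<otimes> am1) + sw (\<psi> b) (\<lambda>b0 b1. (b0 \<cdot> a) \<otimes> b1))"

locale braided_alternative_bialgebra =
  Hopf_bimodule_algebra_coalgebra
    scaleH multH comultH scaleA multA comultA lact ract lcoact rcoact
  for scaleH :: "'k::field_char_0 \<Rightarrow> 'h::ab_group_add \<Rightarrow> 'h"
    and multH :: "'h \<Rightarrow> 'h \<Rightarrow> 'h" (infixl "\<cdot>\<^sub>H" 70)
    and comultH :: "'h \<Rightarrow> ('h \<times> 'h \<Rightarrow>\<^sub>0 'k) set" ("\<Delta>\<^sub>H")
    and scaleA :: "'k \<Rightarrow> 'a::ab_group_add \<Rightarrow> 'a"
    and multA :: "'a \<Rightarrow> 'a \<Rightarrow> 'a" (infixl "\<cdot>" 70)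
    and comultA :: "'a \<Rightarrow> ('a \<times> 'a \<Rightarrow>\<^sub>0 'k) set" ("\<Delta>\<^sub>A")
    and lact :: "'h \<Rightarrow> 'a \<Rightarrow> 'a" (infixr "\<rhd>" 70)
    and ract :: "'a \<Rightarrow> 'h \<Rightarrow> 'a" (infixl "\<lhd>" 70)
    and lcoact :: "'a \<Rightarrow> ('h \<times> 'a \<Rightarrow>\<^sub>0 'k) set" ("\<phi>")
    and rcoact :: "'a \<Rightarrow> ('a \<times> 'h \<Rightarrow>\<^sub>0 'k) set" ("\<psi>") +
  assumes BB1:
      "\<Delta>\<^sub>A (a \<cdot> b) = tensor_class scaleA scaleA
        (sw (\<Delta>\<^sub>A a) (\<lambda>a1 a2. (a1 \<cdot> b) \<otimes> a2) + sw (\<Delta>\<^sub>A a) (\<lambda>a1 a2. (a2 \<cdot> b) \<otimes> a1)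
         - sw (\<Delta>\<^sub>A a) (\<lambda>a1 a2. a2 \<otimes> (b \<cdot> a1)) + sw (\<Delta>\<^sub>A b) (\<lambda>b1 b2. b1 \<otimes> (a \<cdot> b2))
         + sw (\<Delta>\<^sub>A b) (\<lambda>b1 b2. b1 \<otimes> (b2 \<cdot> a)) - sw (\<Delta>\<^sub>A b) (\<lambda>b1 b2. (a \<cdot> b1) \<otimes> b2)
         + sw (\<phi> a) (\<lambda>am1 a0. (am1 \<rhd> b) \<otimes> a0) + sw (\<psi> a) (\<lambda>a0 a1. (a1 \<rhd> b) \<otimes> a0)
         - sw (\<phi> a) (\<lambda>am1 a0. a0 \<otimes> (b \<lhd> am1)) + sw (\<psi> b) (\<lambda>b0 b1. b0 \<otimes> (a \<lhd> b1))
         + sw (\<psi> b) (\<lambda>b0 b1. b0 \<otimes> (b1 \<rhd> a)) - sw (\<phi> b) (\<lambda>bm1 b0. (a \<lhd> bm1) \<otimes> b0))"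
    and BB2:
      "tensor_class scaleA scaleA
         (formal_rep (\<Delta>\<^sub>A (b \<cdot> a)) + flip (formal_rep (\<Delta>\<^sub>A (b \<cdot> a)))) =
       tensor_class scaleA scaleA
        (sw (\<Delta>\<^sub>A a) (\<lambda>a1 a2. a1 \<otimes> (b \<cdot> a2)) + sw (\<Delta>\<^sub>A a) (\<lambda>a1 a2. (b \<cdot> a2) \<otimes> a1)
         + sw (\<Delta>\<^sub>A b) (\<lambda>b1 b2. (b1 \<cdot> a) \<otimes> b2) + sw (\<Delta>\<^sub>A b) (\<lambda>b1 b2. b2 \<otimes> (b1 \<cdot> a))
         + sw (\<psi> a) (\<lambda>a0 a1. a0 \<otimes> (b \<lhd> a1)) + sw (\<psi> a) (\<lambda>a0 a1. (b \<lhd> a1) \<otimes> a0)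
         + sw (\<phi> b) (\<lambda>bm1 b0. b0 \<otimes> (bm1 \<rhd> a)) + sw (\<phi> b) (\<lambda>bm1 b0. (bm1 \<rhd> a) \<otimes> b0))"


section \<open>The biproduct on \<open>E = A \<oplus> H\<close>\<close>

text \<open>\<open>(a, x)\<close> stands for \<open>a + x\<close>; the scalar multiplication of \<open>E\<close> is the library's
  \<open>module_prod.scale scaleA scaleH\<close>.\<close>

fun biproduct_mult ::
  "('h::ab_group_add \<Rightarrow> 'h \<Rightarrow> 'h) \<Rightarrow> ('a::ab_group_add \<Rightarrow> 'a \<Rightarrow> 'a) \<Rightarrow>
   ('h \<Rightarrow> 'a \<Rightarrow> 'a) \<Rightarrow> ('a \<Rightarrow> 'h \<Rightarrow> 'a) \<Rightarrow> 'a \<times> 'h \<Rightarrow> 'a \<times> 'h \<Rightarrow> 'a \<times> 'h" where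
  "biproduct_mult multH multA lact ract (a, x) (b, y) =
     (multA a b + lact x b + ract a y, multH x y)"

fun biproduct_comult ::
  "('k::field_char_0 \<Rightarrow> 'h::ab_group_add \<Rightarrow> 'h) \<Rightarrow> ('h \<Rightarrow> ('h \<times> 'h \<Rightarrow>\<^sub>0 'k) set) \<Rightarrow>
   ('k \<Rightarrow> 'a::ab_group_add \<Rightarrow> 'a) \<Rightarrow> ('a \<Rightarrow> ('a \<times> 'a \<Rightarrow>\<^sub>0 'k) set) \<Rightarrow>
   ('a \<Rightarrow> ('h \<times> 'a \<Rightarrow>\<^sub>0 'k) set) \<Rightarrow> ('a \<Rightarrow> ('a \<times> 'h \<Rightarrow>\<^sub>0 'k) set) \<Rightarrow>
   'a \<times> 'h \<Rightarrow> (('a \<times> 'h) \<times> ('a \<times> 'h) \<Rightarrow>\<^sub>0 'k) set" where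
  "biproduct_comult scaleH comultH scaleA comultA lcoact rcoact (a, x) =
     tensor_class (module_prod.scale scaleA scaleH) (module_prod.scale scaleA scaleH)
      (sw (comultA a) (\<lambda>a1 a2. (a1, 0) \<otimes> (a2, 0))
       + sw (lcoact a) (\<lambda>am1 a0. (0, am1) \<otimes> (a0, 0))
       + sw (rcoact a) (\<lambda>a0 a1. (a0, 0) \<otimes> (0, a1))
       + sw (comultH x) (\<lambda>x1 x2. (0, x1) \<otimes> (0, x2)))"

end

(*
  Over a field, an element of a tensor product vanishes as soon as every multilinear form vanishes
  on it, so every axiom becomes a family of identities between scalars. A form on the tensor square
  or cube of E = A + H is determined by its restrictions to the blocks AA, AH, HA, HH, resp.
  AAA, ..., HHH. Restricted to a block, and to arguments from A or H, each bialgebra axiom of E is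
  one of the axioms of H or of an algebra and coalgebra in the category of Hopf bimodules; the only
  exceptions are the two compatibility axioms for arguments from A on the block AA, which are
  (BB1) and (BB2).
*)

theory Submission
  imports Defs
begin

section \<open>Scalar evaluation of formal sums\<close>

text \<open>Cosets and Sweedler sums resist direct computation: \<open>sw\<close> evaluates at a
  representative picked by Hilbert choice, the one picked for a coproduct on E is unrelated to those
  picked on A and H, and formal sums agree only modulo the relations. A bilinear form takes the same
  value on every representative, which reduces the tensor axioms to linear arithmetic in the field.
  The extra terms of (BB1) and (BB2) are what the unbraided axioms of E themselves produce: for a, b
  in A the coactions give the coproduct of a legs in H, and such a leg, multiplied by b, returns to
  A through an action. Thus the block AA of E sees more than the coproduct of A. Measuring the
  failure of the unbraided axioms on A by a scalar defect allows it to be compared with exactly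
  these terms.\<close>

definition formal_eval :: "('x \<Rightarrow> 'k::field) \<Rightarrow> ('x \<Rightarrow>\<^sub>0 'k) \<Rightarrow> 'k" where
  "formal_eval g t = (\<Sum>x \<in> Poly_Mapping.keys t. Poly_Mapping.lookup t x * g x)"

text \<open>The representative is the one that \<open>sw\<close> picks, so that evaluating
  \<open>sw T f\<close> commutes with the sum for every \<open>f\<close>, bilinear or not.\<close>

definition sw_form :: "('u \<times> 'v \<Rightarrow>\<^sub>0 'k::field) set \<Rightarrow> ('u \<Rightarrow> 'v \<Rightarrow> 'k) \<Rightarrow> 'k" where
  "sw_form T \<beta> = formal_eval (\<lambda>(u, v). \<beta> u v) (SOME t. t \<in> T)"

definition linear_form :: "('k::field \<Rightarrow> 'u::ab_group_add \<Rightarrow> 'u) \<Rightarrow> ('u \<Rightarrow> 'k) \<Rightarrow> bool" where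
  "linear_form s f \<longleftrightarrow> (\<forall>u v. f (u + v) = f u + f v) \<and> (\<forall>c u. f (s c u) = c * f u)"

definition bilinear_form ::
  "('k::field \<Rightarrow> 'u::ab_group_add \<Rightarrow> 'u) \<Rightarrow> ('k \<Rightarrow> 'v::ab_group_add \<Rightarrow> 'v) \<Rightarrow>
   ('u \<Rightarrow> 'v \<Rightarrow> 'k) \<Rightarrow> bool" where
  "bilinear_form s1 s2 \<beta> \<longleftrightarrow>
     (\<forall>v. linear_form s1 (\<lambda>u. \<beta> u v)) \<and> (\<forall>u. linear_form s2 (\<lambda>v. \<beta> u v))"

text \<open>The two slices overlap in the middle argument and together give linearity in all three.
  They are the forms met by an inner coproduct in \<open>tensor_id\<close> and
  \<open>id_tensor\<close> respectively.\<close>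

definition trilinear_form ::
  "('k::field \<Rightarrow> 'u::ab_group_add \<Rightarrow> 'u) \<Rightarrow> ('k \<Rightarrow> 'v::ab_group_add \<Rightarrow> 'v) \<Rightarrow>
   ('k \<Rightarrow> 'w::ab_group_add \<Rightarrow> 'w) \<Rightarrow> ('u \<Rightarrow> 'v \<Rightarrow> 'w \<Rightarrow> 'k) \<Rightarrow> bool" where
  "trilinear_form s1 s2 s3 \<gamma> \<longleftrightarrow>
     (\<forall>w. bilinear_form s1 s2 (\<lambda>u v. \<gamma> u v w)) \<and> (\<forall>u. bilinear_form s2 s3 (\<gamma> u))"

lemma linear_form_simps:
  assumes "linear_form s f"
  shows linear_form_add: "f (u + v) = f u + f v" and linear_form_scale: "f (s c u) = c * f u"
    and linear_form_zero: "f 0 = 0" and linear_form_minus: "f (- u) = - f u"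
    and linear_form_diff: "f (u - v) = f u - f v"
proof -
  show add: "f (u + v) = f u + f v" for u v
    using assms by (simp add: linear_form_def)
  show "f (s c u) = c * f u"
    using assms by (simp add: linear_form_def)
  show zero: "f 0 = 0"
    using add[of 0 0] by (metis add.right_neutral add_left_cancel)
  show minus: "f (- u) = - f u" for u
    using add[of u "- u"] by (simp add: zero eq_neg_iff_add_eq_0 add.commute)
  show "f (u - v) = f u - f v"
    using add[of u "- v"] by (simp add: minus)
qed

lemma bilinear_form_linear:
  assumes "bilinear_form s1 s2 \<beta>"
  shows bilinear_form_linear1: "linear_form s1 (\<lambda>u. \<beta> u v)"
    and bilinear_form_linear2: "linear_form s2 (\<beta> u)"
  using assms by (auto simp: bilinear_form_def)

lemmas bilinear_form_simps =
  linear_form_simps(1,3)[OF bilinear_form_linear1] linear_form_simps(1,3)[OF bilinear_form_linear2]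

lemma trilinear_form_bilinear:
  assumes "trilinear_form s1 s2 s3 \<gamma>"
  shows trilinear_form_bilinear12: "bilinear_form s1 s2 (\<lambda>u v. \<gamma> u v w)"
    and trilinear_form_bilinear23: "bilinear_form s2 s3 (\<gamma> u)"
  using assms by (auto simp: trilinear_form_def bilinear_form_def)

lemma formal_eval_superset:
  assumes "finite S" "Poly_Mapping.keys t \<subseteq> S"
  shows "formal_eval g t = (\<Sum>x\<in>S. Poly_Mapping.lookup t x * g x)"
  unfolding formal_eval_def
  by (rule sum.mono_neutral_left) (use assms in \<open>auto simp: in_keys_iff\<close>)

lemma formal_eval_linear:
  fixes g :: "'x \<Rightarrow> 'k::field"
  shows "linear_form formal_scale (formal_eval g)"
  unfolding linear_form_def
proof (intro conjI allI)
  fix s t :: "'x \<Rightarrow>\<^sub>0 'k"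
  let ?S = "Poly_Mapping.keys s \<union> Poly_Mapping.keys t"
  have "formal_eval g (s + t) = (\<Sum>x\<in>?S. Poly_Mapping.lookup (s + t) x * g x)"
    by (rule formal_eval_superset) (auto dest: set_mp[OF Poly_Mapping.keys_add])
  then show "formal_eval g (s + t) = formal_eval g s + formal_eval g t"
    by (simp add: formal_eval_superset[of ?S] lookup_add distrib_right sum.distrib)
next
  fix c and t :: "'x \<Rightarrow>\<^sub>0 'k"
  have "formal_eval g (formal_scale c t) =
      (\<Sum>x\<in>Poly_Mapping.keys t. Poly_Mapping.lookup (formal_scale c t) x * g x)"
    by (rule formal_eval_superset) (auto simp: in_keys_iff)
  then show "formal_eval g (formal_scale c t) = c * formal_eval g t"
    by (simp add: formal_eval_def sum_distrib_left mult.assoc)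
qed

lemmas formal_eval_simps [simp] = linear_form_simps[OF formal_eval_linear]

lemma formal_eval_single [simp]: "formal_eval g (Poly_Mapping.single x 1) = g x"
  by (simp add: formal_eval_def)

lemma formal_eval_pure [simp]:
  "formal_eval g (u \<otimes> v) = g (u, v)" "formal_eval h (pure3 u v w) = h (u, v, w)"
  by (simp_all add: pure2_def pure3_def)

lemma formal_eval_form_simps [simp]:
  "formal_eval (\<lambda>x. g x + h x) t = formal_eval g t + formal_eval h t"
  "formal_eval (\<lambda>x. g x - h x) t = formal_eval g t - formal_eval h t"
  "formal_eval (\<lambda>x. - g x) t = - formal_eval g t"
  "formal_eval (\<lambda>x. c * g x) t = c * formal_eval g t"
  "formal_eval (\<lambda>x. 0) t = 0"
  by (simp_all add: formal_eval_def algebra_simps sum.distrib sum_subtractf sum_negf sum_distrib_left)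

lemma formal_eval_extend [simp]:
  "formal_eval g (formal_extend f t) = formal_eval (\<lambda>x. formal_eval g (f x)) t"
proof -
  have "formal_eval g (\<Sum>x\<in>X. h x) = (\<Sum>x\<in>X. formal_eval g (h x))" for h and X :: "'c set"
    by (induction X rule: infinite_finite_induct) auto
  then show ?thesis
    by (simp add: formal_extend_def formal_eval_def[of "\<lambda>x. formal_eval g (f x)"])
qed

text \<open>The elements \<open>Poly_Mapping.single x 1\<close> form a basis of the free vector
  space. This turns an abstract functional, obtained by basis extension, into a function on
  generators.\<close>

lemma linear_form_eq_formal_eval:
  fixes L :: "('x \<Rightarrow>\<^sub>0 'k::field) \<Rightarrow> 'k"
  assumes "linear_form formal_scale L"
  shows "L t = formal_eval (\<lambda>x. L (Poly_Mapping.single x 1)) t"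
proof -
  have "formal_extend (\<lambda>x. Poly_Mapping.single x 1) t = t"
    by (rule poly_mapping_eqI)
      (simp add: formal_extend_def lookup_sum lookup_single when_def in_keys_iff sum.delta
        if_distrib[of "\<lambda>z. _ * z"] cong: if_cong)
  moreover have "L (\<Sum>x\<in>X. h x) = (\<Sum>x\<in>X. L (h x))" for h and X :: "'x set"
    by (induction X rule: infinite_finite_induct) (auto simp: linear_form_simps[OF assms])
  then have "L (formal_extend (\<lambda>x. Poly_Mapping.single x 1) t) =
      (\<Sum>x\<in>Poly_Mapping.keys t. Poly_Mapping.lookup t x * L (Poly_Mapping.single x 1))"
    by (simp add: formal_extend_def linear_form_scale[OF assms])
  ultimately show ?thesis
    by (simp add: formal_eval_def)
qed

text \<open>Only the integrand varies while \<open>T\<close>, and with it the chosen representative,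
  stays fixed. Hence neither bilinearity nor any property of \<open>T\<close> enters.\<close>

lemma sw_form_simps [simp]:
  "sw_form T (\<lambda>u v. \<beta> u v + \<beta>' u v) = sw_form T \<beta> + sw_form T \<beta>'"
  "sw_form T (\<lambda>u v. \<beta> u v - \<beta>' u v) = sw_form T \<beta> - sw_form T \<beta>'"
  "sw_form T (\<lambda>u v. - \<beta> u v) = - sw_form T \<beta>"
  "sw_form T (\<lambda>u v. c * \<beta> u v) = c * sw_form T \<beta>"
  "sw_form T (\<lambda>u v. 0) = 0"
  by (simp_all add: sw_form_def case_prod_unfold)

lemma formal_eval_sw [simp]:
  "formal_eval g (sw T f) = sw_form T (\<lambda>u v. formal_eval g (f u v))"
  by (simp add: sw_def sw_form_def case_prod_unfold)

lemma formal_eval_tensor_ops [simp]: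
  "formal_eval g (formal_rep T) = sw_form T (\<lambda>u v. g (u, v))"
  "formal_eval h (tensor_id f T) = sw_form T (\<lambda>u v. sw_form (f u) (\<lambda>p q. h (p, q, v)))"
  "formal_eval h' (id_tensor f' T) = sw_form T (\<lambda>u v. sw_form (f' v) (\<lambda>p q. h' (u, p, q)))"
  by (simp_all add: formal_rep_def tensor_id_def id_tensor_def)

lemma formal_eval_flip [simp]:
  "formal_eval g (flip t) = formal_eval (\<lambda>(u, v). g (v, u)) t"
  "formal_eval h (flip12 t3) = formal_eval (\<lambda>(u, v, w). h (v, u, w)) t3"
  "formal_eval h' (flip23 t3') = formal_eval (\<lambda>(u, v, w). h' (u, w, v)) t3'"
  by (simp_all add: flip_def flip12_def flip23_def case_prod_unfold)


section \<open>Forms separate the points of a tensor product\<close>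

text \<open>A basis of \<open>N\<close> stays independent after adding \<open>t\<close>, so some
  functional is 0 on that basis, hence on \<open>N\<close>, and 1 at \<open>t\<close>.\<close>

lemma subspace_separation:
  fixes N :: "('x \<Rightarrow>\<^sub>0 'k::field) set"
  assumes N: "formal.subspace N" and t: "t \<notin> N"
  obtains g where "\<And>s. s \<in> N \<Longrightarrow> formal_eval g s = 0" "formal_eval g t \<noteq> 0"
proof -
  interpret vp: vector_space_pair formal_scale "(*) :: 'k \<Rightarrow> 'k \<Rightarrow> 'k"
    by unfold_locales (auto simp: algebra_simps)
  obtain B where B: "B \<subseteq> N" "formal.independent B" "N \<subseteq> formal.span B"
    using formal.maximal_independent_subset[of N] by metis
  have "formal.span B \<subseteq> N"
    using B(1) N by (rule formal.span_minimal)
  with t B(2) have ind: "formal.independent (insert t B)"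
    by (intro formal.independent_insertI) auto
  obtain L where L: "Vector_Spaces.linear formal_scale (*) L"
    "\<forall>x\<in>insert t B. L x = (if x = t then 1 else (0::'k))"
    using vp.linear_independent_extend[OF ind, of "\<lambda>x. if x = t then 1 else 0"] by blast
  then have lin: "linear_form formal_scale L"
    by (simp add: Vector_Spaces.linear_iff linear_form_def)
  define g where "g x = L (Poly_Mapping.single x 1)" for x
  have g: "formal_eval g s = L s" for s
    unfolding g_def by (rule linear_form_eq_formal_eval[OF lin, symmetric])
  have "L s = 0" if "s \<in> formal.span B" for s
    using that
  proof (induction rule: formal.span_induct)
    case base
    show ?case
      by (simp add: formal.subspace_def linear_form_simps[OF lin])
  next
    case (step x)
    moreover from step have "x \<noteq> t"
      using B(1) t by auto
    ultimately show ?case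
      using L(2) by auto
  qed
  then have "formal_eval g s = 0" if "s \<in> N" for s
    using that B(3) by (auto simp only: g)
  moreover have "formal_eval g t \<noteq> 0"
    using L(2) by (simp only: g) simp
  ultimately show thesis
    by (rule that)
qed

lemma subspace_kernel_formal_eval: "formal.subspace {t. formal_eval g t = 0}"
  by (simp add: formal.subspace_def)

lemma formal_eval_tensor_null:
  assumes "bilinear_form s1 s2 \<beta>" "t \<in> tensor_null s1 s2"
  shows "formal_eval (\<lambda>(u, v). \<beta> u v) t = 0"
  using assms(2) unfolding tensor_null_def
proof (induction rule: formal.span_induct)
  case base
  show ?case by (rule subspace_kernel_formal_eval)
next
  case (step x)
  with assms(1) show ?case
    by (auto simp: bilinear_form_def linear_form_def)
qed

lemma formal_eval_tensor_null3:
  assumes "trilinear_form s1 s2 s3 \<gamma>" "t \<in> tensor_null3 s1 s2 s3"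
  shows "formal_eval (\<lambda>(u, v, w). \<gamma> u v w) t = 0"
  using assms(2) unfolding tensor_null3_def
proof (induction rule: formal.span_induct)
  case base
  show ?case by (rule subspace_kernel_formal_eval)
next
  case (step x)
  with assms(1) show ?case
    by (auto simp: trilinear_form_def bilinear_form_def linear_form_def)
qed

text \<open>A functional that kills all relations is the same thing as a bilinear form: each of the
  four families of generators, evaluated to 0, is one law of bilinearity. So the functional
  separating \<open>t\<close> from the relations is itself a form on which \<open>t\<close> does not
  vanish.\<close>

lemma tensor_null_iff:
  "t \<in> tensor_null s1 s2 \<longleftrightarrow>
    (\<forall>\<beta>. bilinear_form s1 s2 \<beta> \<longrightarrow> formal_eval (\<lambda>(u, v). \<beta> u v) t = 0)"
proof (intro iffI allI impI)
  assume *: "\<forall>\<beta>. bilinear_form s1 s2 \<beta> \<longrightarrow> formal_eval (\<lambda>(u, v). \<beta> u v) t = 0"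
  have sub: "formal.subspace (tensor_null s1 s2)"
    by (simp add: tensor_null_def)
  show "t \<in> tensor_null s1 s2"
  proof (rule ccontr)
    assume "t \<notin> tensor_null s1 s2"
    with sub obtain g
      where g: "\<And>s. s \<in> tensor_null s1 s2 \<Longrightarrow> formal_eval g s = 0" "formal_eval g t \<noteq> 0"
      by (rule subspace_separation) auto
    have "bilinear_form s1 s2 (\<lambda>u v. g (u, v))"
      unfolding bilinear_form_def linear_form_def
    proof (intro conjI allI)
      fix u u' v show "g (u + u', v) = g (u, v) + g (u', v)"
        using g(1)[of "(u + u') \<otimes> v - u \<otimes> v - u' \<otimes> v"]
        by (force simp: tensor_null_def diff_diff_eq intro: formal.span_base)
    next
      fix c u v show "g (s1 c u, v) = c * g (u, v)"
        using g(1)[of "s1 c u \<otimes> v - formal_scale c (u \<otimes> v)"]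
        by (force simp: tensor_null_def intro: formal.span_base)
    next
      fix u v v' show "g (u, v + v') = g (u, v) + g (u, v')"
        using g(1)[of "u \<otimes> (v + v') - u \<otimes> v - u \<otimes> v'"]
        by (force simp: tensor_null_def diff_diff_eq intro: formal.span_base)
    next
      fix c u v show "g (u, s2 c v) = c * g (u, v)"
        using g(1)[of "u \<otimes> s2 c v - formal_scale c (u \<otimes> v)"]
        by (force simp: tensor_null_def intro: formal.span_base)
    qed
    with * g(2) show False
      by fastforce
  qed
qed (rule formal_eval_tensor_null)

lemma tensor_null3_iff:
  "t \<in> tensor_null3 s1 s2 s3 \<longleftrightarrow>
    (\<forall>\<gamma>. trilinear_form s1 s2 s3 \<gamma> \<longrightarrow> formal_eval (\<lambda>(u, v, w). \<gamma> u v w) t = 0)"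
proof (intro iffI allI impI)
  assume *: "\<forall>\<gamma>. trilinear_form s1 s2 s3 \<gamma> \<longrightarrow> formal_eval (\<lambda>(u, v, w). \<gamma> u v w) t = 0"
  have sub: "formal.subspace (tensor_null3 s1 s2 s3)"
    by (simp add: tensor_null3_def)
  show "t \<in> tensor_null3 s1 s2 s3"
  proof (rule ccontr)
    assume "t \<notin> tensor_null3 s1 s2 s3"
    with sub obtain g
      where g: "\<And>s. s \<in> tensor_null3 s1 s2 s3 \<Longrightarrow> formal_eval g s = 0" "formal_eval g t \<noteq> 0"
      by (rule subspace_separation) auto
    have "g (u + u', v, w) = g (u, v, w) + g (u', v, w)" for u u' v w
      using g(1)[of "pure3 (u + u') v w - pure3 u v w - pure3 u' v w"]
      by (force simp: tensor_null3_def diff_diff_eq intro: formal.span_base)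
    moreover have "g (u, v + v', w) = g (u, v, w) + g (u, v', w)" for u v v' w
      using g(1)[of "pure3 u (v + v') w - pure3 u v w - pure3 u v' w"]
      by (force simp: tensor_null3_def diff_diff_eq intro: formal.span_base)
    moreover have "g (u, v, w + w') = g (u, v, w) + g (u, v, w')" for u v w w'
      using g(1)[of "pure3 u v (w + w') - pure3 u v w - pure3 u v w'"]
      by (force simp: tensor_null3_def diff_diff_eq intro: formal.span_base)
    moreover have "g (s1 c u, v, w) = c * g (u, v, w)" for c u v w
      using g(1)[of "pure3 (s1 c u) v w - formal_scale c (pure3 u v w)"]
      by (force simp: tensor_null3_def intro: formal.span_base)
    moreover have "g (u, s2 c v, w) = c * g (u, v, w)" for c u v w
      using g(1)[of "pure3 u (s2 c v) w - formal_scale c (pure3 u v w)"]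
      by (force simp: tensor_null3_def intro: formal.span_base)
    moreover have "g (u, v, s3 c w) = c * g (u, v, w)" for c u v w
      using g(1)[of "pure3 u v (s3 c w) - formal_scale c (pure3 u v w)"]
      by (force simp: tensor_null3_def intro: formal.span_base)
    ultimately have "trilinear_form s1 s2 s3 (\<lambda>u v w. g (u, v, w))"
      by (simp add: trilinear_form_def bilinear_form_def linear_form_def)
    with * g(2) show False
      by fastforce
  qed
qed (rule formal_eval_tensor_null3)

section \<open>Equality of cosets and linearity of coproducts, tested by forms\<close>

lemma mem_tensor_class_iff:
  "t' \<in> tensor_class s1 s2 t \<longleftrightarrow>
    (\<forall>\<beta>. bilinear_form s1 s2 \<beta> \<longrightarrow>
      formal_eval (\<lambda>(u, v). \<beta> u v) t' = formal_eval (\<lambda>(u, v). \<beta> u v) t)"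
  by (simp add: tensor_class_def tensor_null_iff)

lemma tensor_class_eq_iff:
  "tensor_class s1 s2 t = tensor_class s1 s2 t' \<longleftrightarrow>
    (\<forall>\<beta>. bilinear_form s1 s2 \<beta> \<longrightarrow>
      formal_eval (\<lambda>(u, v). \<beta> u v) t = formal_eval (\<lambda>(u, v). \<beta> u v) t')"
proof
  assume "tensor_class s1 s2 t = tensor_class s1 s2 t'"
  moreover have "t \<in> tensor_class s1 s2 t"
    by (simp add: mem_tensor_class_iff)
  ultimately show "\<forall>\<beta>. bilinear_form s1 s2 \<beta> \<longrightarrow>
      formal_eval (\<lambda>(u, v). \<beta> u v) t = formal_eval (\<lambda>(u, v). \<beta> u v) t'"
    by (simp add: mem_tensor_class_iff)
qed (auto simp: mem_tensor_class_iff)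

lemma tensor_class3_eq_iff:
  "tensor_class3 s1 s2 s3 t = tensor_class3 s1 s2 s3 t' \<longleftrightarrow>
    (\<forall>\<gamma>. trilinear_form s1 s2 s3 \<gamma> \<longrightarrow>
      formal_eval (\<lambda>(u, v, w). \<gamma> u v w) t = formal_eval (\<lambda>(u, v, w). \<gamma> u v w) t')"
proof
  assume "tensor_class3 s1 s2 s3 t = tensor_class3 s1 s2 s3 t'"
  moreover have "t \<in> tensor_class3 s1 s2 s3 t"
    by (simp add: tensor_class3_def tensor_null3_iff)
  ultimately show "\<forall>\<gamma>. trilinear_form s1 s2 s3 \<gamma> \<longrightarrow>
      formal_eval (\<lambda>(u, v, w). \<gamma> u v w) t = formal_eval (\<lambda>(u, v, w). \<gamma> u v w) t'"
    by (simp add: tensor_class3_def tensor_null3_iff)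
qed (auto simp: tensor_class3_def tensor_null3_iff)

text \<open>Here the Hilbert choice disappears: the chosen element lies in the coset, on which the
  form is constant.\<close>

lemma sw_form_tensor_class:
  assumes "bilinear_form s1 s2 \<beta>"
  shows "sw_form (tensor_class s1 s2 t) \<beta> = formal_eval (\<lambda>(u, v). \<beta> u v) t"
proof -
  have "t \<in> tensor_class s1 s2 t"
    by (simp add: mem_tensor_class_iff)
  then have "(SOME t'. t' \<in> tensor_class s1 s2 t) \<in> tensor_class s1 s2 t"
    by (rule someI)
  with assms show ?thesis
    by (simp add: sw_form_def mem_tensor_class_iff)
qed

text \<open>Serves axioms whose left side is a bare value such as
  \<open>\<Delta> (a \<cdot> b)\<close>. Scalars determine it only once it is known to be a whole
  coset, which linearity of the coproduct supplies.\<close>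

lemma tensor_space_eq_iff:
  assumes "T \<in> tensor_space s1 s2"
  shows "T = tensor_class s1 s2 t \<longleftrightarrow>
    (\<forall>\<beta>. bilinear_form s1 s2 \<beta> \<longrightarrow> sw_form T \<beta> = formal_eval (\<lambda>(u, v). \<beta> u v) t)"
proof -
  obtain t' where "T = tensor_class s1 s2 t'"
    using assms by (auto simp: tensor_space_def)
  then show ?thesis
    by (simp add: tensor_class_eq_iff sw_form_tensor_class)
qed

lemma mem_tensor_space_iff:
  assumes "T \<in> tensor_space s1 s2"
  shows "t \<in> T \<longleftrightarrow>
    (\<forall>\<beta>. bilinear_form s1 s2 \<beta> \<longrightarrow> formal_eval (\<lambda>(u, v). \<beta> u v) t = sw_form T \<beta>)"
proof -
  obtain t' where "T = tensor_class s1 s2 t'"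
    using assms by (auto simp: tensor_space_def)
  then show ?thesis
    by (simp add: mem_tensor_class_iff sw_form_tensor_class)
qed

lemma linear_to_tensor_iff:
  "linear_to_tensor s s1 s2 f \<longleftrightarrow>
    (\<forall>v. f v \<in> tensor_space s1 s2) \<and>
    (\<forall>\<beta>. bilinear_form s1 s2 \<beta> \<longrightarrow> linear_form s (\<lambda>v. sw_form (f v) \<beta>))"
    (is "?L \<longleftrightarrow> ?R")
proof
  assume L: ?L
  then have sp: "f v \<in> tensor_space s1 s2" for v
    by (simp add: linear_to_tensor_def)
  \<comment> \<open>Cosets are inhabited, so the closure conditions, which quantify over
    representatives, say something about every \<open>v\<close>.\<close>
  have "\<exists>t. t \<in> f v" for v
    using sp[of v] by (auto simp: tensor_space_def tensor_class_def tensor_null_iff)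
  then obtain F where F: "F v \<in> f v" for v
    by metis
  have "F v + F w \<in> f (v + w)" "formal_scale c (F v) \<in> f (s c v)" for v w c
    using L F by (auto simp: linear_to_tensor_def)
  then have "formal_eval (\<lambda>(u, v). \<beta> u v) (F v + F w) = sw_form (f (v + w)) \<beta>"
    "formal_eval (\<lambda>(u, v). \<beta> u v) (formal_scale c (F v)) = sw_form (f (s c v)) \<beta>"
    if "bilinear_form s1 s2 \<beta>" for v w c \<beta>
    using that mem_tensor_space_iff[OF sp] by blast+
  moreover have "formal_eval (\<lambda>(u, v). \<beta> u v) (F v) = sw_form (f v) \<beta>"
    if "bilinear_form s1 s2 \<beta>" for v \<beta>
    using that mem_tensor_space_iff[OF sp] F by blast
  ultimately show ?R
    using sp by (simp add: linear_form_def)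
next
  assume R: ?R
  then have sp: "f v \<in> tensor_space s1 s2" for v
    by simp
  have "t + t' \<in> f (v + w)" if "t \<in> f v" "t' \<in> f w" for t t' v w
    using that R by (auto simp: mem_tensor_space_iff[OF sp] linear_form_def)
  moreover have "formal_scale c t \<in> f (s c v)" if "t \<in> f v" for t c v
    using that R by (auto simp: mem_tensor_space_iff[OF sp] linear_form_def)
  ultimately show ?L
    using sp by (auto simp: linear_to_tensor_def)
qed


section \<open>Composition of forms with linear maps\<close>

lemma linear_form_sw:
  "linear_to_tensor s s1 s2 f \<Longrightarrow> bilinear_form s1 s2 \<beta> \<Longrightarrow> linear_form s (\<lambda>v. sw_form (f v) \<beta>)"
  by (simp add: linear_to_tensor_iff)

lemma bilinear_form_sw1:
  assumes "linear_to_tensor s p q f" "trilinear_form p q t \<gamma>"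
  shows "bilinear_form s t (\<lambda>u v. sw_form (f u) (\<lambda>a b. \<gamma> a b v))"
  using linear_form_sw[OF assms(1) trilinear_form_bilinear12[OF assms(2)]] assms(2)
  by (auto simp: trilinear_form_def bilinear_form_def linear_form_def)

lemma bilinear_form_sw2:
  assumes "linear_to_tensor s p q f" "trilinear_form t p q \<gamma>"
  shows "bilinear_form t s (\<lambda>u v. sw_form (f v) (\<lambda>a b. \<gamma> u a b))"
proof -
  \<comment> \<open>Equations between functions are needed:
    \<open>\<lambda>a b. \<gamma> u a b\<close> contracts to \<open>\<gamma> u\<close>, where the
    pointwise laws no longer match.\<close>
  have "\<gamma> (u + u') = (\<lambda>a b. \<gamma> u a b + \<gamma> u' a b)" "\<gamma> (t c u) = (\<lambda>a b. c * \<gamma> u a b)" for u u' c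
    using assms(2) by (auto intro!: ext simp: trilinear_form_def bilinear_form_def linear_form_def)
  then show ?thesis
    using linear_form_sw[OF assms(1) trilinear_form_bilinear23[OF assms(2)]]
    by (simp add: bilinear_form_def linear_form_def)
qed

lemma bilinear_form_flip:
  "bilinear_form s1 s2 \<beta> \<Longrightarrow> bilinear_form s2 s1 (\<lambda>v u. \<beta> u v)"
  by (simp add: bilinear_form_def)

lemma trilinear_form_flip:
  assumes "trilinear_form s1 s2 s3 \<gamma>"
  shows trilinear_form_flip12: "trilinear_form s2 s1 s3 (\<lambda>v u w. \<gamma> u v w)"
    and trilinear_form_flip23: "trilinear_form s1 s3 s2 (\<lambda>u w v. \<gamma> u v w)"
  using assms by (auto simp: trilinear_form_def bilinear_form_def)

text \<open>With the inclusions of A and H for \<open>i\<close> and \<open>j\<close>, this restricts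
  a form on the square of E to a block.\<close>

lemma bilinear_form_compose:
  assumes "bilinear_form t1 t2 \<beta>" "Vector_Spaces.linear s1 t1 i" "Vector_Spaces.linear s2 t2 j"
  shows "bilinear_form s1 s2 (\<lambda>u v. \<beta> (i u) (j v))"
  using assms by (simp add: bilinear_form_def linear_form_def Vector_Spaces.linear_iff)

lemma trilinear_form_compose:
  assumes "trilinear_form t1 t2 t3 \<gamma>" "Vector_Spaces.linear s1 t1 i"
    "Vector_Spaces.linear s2 t2 j" "Vector_Spaces.linear s3 t3 k"
  shows "trilinear_form s1 s2 s3 (\<lambda>u v w. \<gamma> (i u) (j v) (k w))"
  using assms
  by (simp add: trilinear_form_def bilinear_form_def linear_form_def Vector_Spaces.linear_iff)

lemma bilinear_map_simps:
  assumes "bilinear_map s1 s2 s3 f"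
  shows "f (u + u') v = f u v + f u' v" "f u (v + v') = f u v + f u v'"
    "f (s1 c u) v = s3 c (f u v)" "f u (s2 c v) = s3 c (f u v)" "f 0 v = 0" "f u 0 = 0"
proof -
  show *: "f (u + u') v = f u v + f u' v" "f u (v + v') = f u v + f u v'" for u u' v v'
    using assms by (simp_all add: bilinear_map_def Vector_Spaces.linear_iff)
  show "f (s1 c u) v = s3 c (f u v)" "f u (s2 c v) = s3 c (f u v)"
    using assms by (simp_all add: bilinear_map_def Vector_Spaces.linear_iff)
  show "f 0 v = 0" "f u 0 = 0"
    using *(1)[of 0 0 v] *(2)[of u 0 0] by (simp_all del: *)
qed

lemma bilinear_form_split:
  assumes "bilinear_form (module_prod.scale s1 s2) (module_prod.scale s1 s2) \<beta>"
  shows "\<beta> (a, x) (b, y) =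
    \<beta> (a, 0) (b, 0) + \<beta> (a, 0) (0, y) + \<beta> (0, x) (b, 0) + \<beta> (0, x) (0, y)"
proof -
  have "(a, x) = (a, 0) + (0, x)" "(b, y) = (b, 0) + (0, y)"
    by simp_all
  then show ?thesis
    by (simp only: bilinear_form_simps[OF assms] ac_simps)
qed

text \<open>These are the integrands of the two bialgebra axioms: six shapes occur in the formula
  for the coproduct of a product, and the symmetrized axiom adds two more.\<close>

lemma bilinear_form_mult:
  assumes "bilinear_form s s \<beta>" "bilinear_map s s s m"
  shows "bilinear_form s s (\<lambda>u v. \<beta> (m u q) v)" "bilinear_form s s (\<lambda>u v. \<beta> u (m q v))"
    "bilinear_form s s (\<lambda>u v. \<beta> (m q u) v)" "bilinear_form s s (\<lambda>u v. \<beta> u (m v q))"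
    "bilinear_form s s (\<lambda>u v. \<beta> (m v q) u)" "bilinear_form s s (\<lambda>u v. \<beta> v (m q u))"
    "bilinear_form s s (\<lambda>u v. \<beta> (m q v) u)" "bilinear_form s s (\<lambda>u v. \<beta> v (m u q))"
  using assms(1) by (simp_all add: bilinear_form_def linear_form_def bilinear_map_simps[OF assms(2)])

lemma sw_form_eqD:
  "T = tensor_class s1 s2 t \<Longrightarrow> bilinear_form s1 s2 \<beta> \<Longrightarrow>
    sw_form T \<beta> = formal_eval (\<lambda>(u, v). \<beta> u v) t"
  by (simp add: sw_form_tensor_class)

lemma tensor_class_eqD:
  "tensor_class s1 s2 t = tensor_class s1 s2 t' \<Longrightarrow> bilinear_form s1 s2 \<beta> \<Longrightarrow>
    formal_eval (\<lambda>(u, v). \<beta> u v) t = formal_eval (\<lambda>(u, v). \<beta> u v) t'"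
  by (simp add: tensor_class_eq_iff)

text \<open>The symmetrized axioms determine only a sum. Solved for the unflipped term, they become
  rewrite rules whose remaining flipped term cancels against the one in
  \<open>sym_defect\<close>.\<close>

lemma sw_form_add_flip_eqD:
  assumes "tensor_class s1 s2 (formal_rep T + flip (formal_rep T')) = tensor_class s1 s2 t"
    "bilinear_form s1 s2 \<beta>"
  shows "sw_form T \<beta> = formal_eval (\<lambda>(u, v). \<beta> u v) t - sw_form T' (\<lambda>u v. \<beta> v u)"
  using tensor_class_eqD[OF assms] by (simp add: eq_diff_eq)

lemma tensor_class3_eqD:
  "tensor_class3 s1 s2 s3 t = tensor_class3 s1 s2 s3 t' \<Longrightarrow> trilinear_form s1 s2 s3 \<gamma> \<Longrightarrow>
    formal_eval (\<lambda>(u, v, w). \<gamma> u v w) t = formal_eval (\<lambda>(u, v, w). \<gamma> u v w) t'"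
  by (simp add: tensor_class3_eq_iff)


section \<open>The biproduct\<close>

text \<open>Left side minus right side of the compatibility axiom, for an arbitrary product and
  coproduct: one expression serves E, where it has to vanish, and A, where it has to equal the
  braiding terms.\<close>

definition mult_defect ::
  "('a \<Rightarrow> 'a \<Rightarrow> 'a) \<Rightarrow> ('a \<Rightarrow> ('a \<times> 'a \<Rightarrow>\<^sub>0 'k::field) set) \<Rightarrow> ('a \<Rightarrow> 'a \<Rightarrow> 'k) \<Rightarrow> 'a \<Rightarrow> 'a \<Rightarrow> 'k" where
  "mult_defect m \<Delta> \<beta> a b = sw_form (\<Delta> (m a b)) \<beta> -
     (sw_form (\<Delta> a) (\<lambda>a1 a2. \<beta> (m a1 b) a2) + sw_form (\<Delta> a) (\<lambda>a1 a2. \<beta> (m a2 b) a1)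
      - sw_form (\<Delta> a) (\<lambda>a1 a2. \<beta> a2 (m b a1)) + sw_form (\<Delta> b) (\<lambda>b1 b2. \<beta> b1 (m a b2))
      + sw_form (\<Delta> b) (\<lambda>b1 b2. \<beta> b1 (m b2 a)) - sw_form (\<Delta> b) (\<lambda>b1 b2. \<beta> (m a b1) b2))"

definition sym_defect ::
  "('a \<Rightarrow> 'a \<Rightarrow> 'a) \<Rightarrow> ('a \<Rightarrow> ('a \<times> 'a \<Rightarrow>\<^sub>0 'k::field) set) \<Rightarrow> ('a \<Rightarrow> 'a \<Rightarrow> 'k) \<Rightarrow> 'a \<Rightarrow> 'a \<Rightarrow> 'k" where
  "sym_defect m \<Delta> \<beta> a b =
     sw_form (\<Delta> (m b a)) \<beta> + sw_form (\<Delta> (m b a)) (\<lambda>c1 c2. \<beta> c2 c1) -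
     (sw_form (\<Delta> a) (\<lambda>a1 a2. \<beta> a1 (m b a2)) + sw_form (\<Delta> a) (\<lambda>a1 a2. \<beta> (m b a2) a1)
      + sw_form (\<Delta> b) (\<lambda>b1 b2. \<beta> (m b1 a) b2) + sw_form (\<Delta> b) (\<lambda>b1 b2. \<beta> b2 (m b1 a)))"

lemma (in alternative_bialgebra) bialgebra_defects:
  assumes "bilinear_form scale scale \<beta>"
  shows "mult_defect (\<cdot>) \<Delta> \<beta> a b = 0" "sym_defect (\<cdot>) \<Delta> \<beta> a b = 0"
  using sw_form_eqD[OF comult_mult[of a b] assms] tensor_class_eqD[OF comult_mult_sym[of b a] assms]
  by (simp_all add: mult_defect_def sym_defect_def)

lemma alternative_bialgebra_iff_defects:
  assumes "alternative_algebra s m" "alternative_coalgebra s \<Delta>"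
  shows "alternative_bialgebra s m \<Delta> \<longleftrightarrow>
    (\<forall>\<beta> a b. bilinear_form s s \<beta> \<longrightarrow> mult_defect m \<Delta> \<beta> a b = 0 \<and> sym_defect m \<Delta> \<beta> a b = 0)"
proof
  assume "alternative_bialgebra s m \<Delta>"
  then show "\<forall>\<beta> a b. bilinear_form s s \<beta> \<longrightarrow> mult_defect m \<Delta> \<beta> a b = 0 \<and> sym_defect m \<Delta> \<beta> a b = 0"
    by (simp add: alternative_bialgebra.bialgebra_defects)
next
  assume *: "\<forall>\<beta> a b. bilinear_form s s \<beta> \<longrightarrow> mult_defect m \<Delta> \<beta> a b = 0 \<and> sym_defect m \<Delta> \<beta> a b = 0"
  interpret algebra: alternative_algebra s m by fact
  interpret coalgebra: alternative_coalgebra s \<Delta> by fact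
  have space: "\<Delta> a \<in> tensor_space s s" for a
    using coalgebra.comult_linear by (simp add: linear_to_tensor_def)
  show "alternative_bialgebra s m \<Delta>"
  proof (intro alternative_bialgebra.intro alternative_bialgebra_axioms.intro assms, goal_cases)
    case (1 a b)
    with * show ?case
      by (auto simp: tensor_space_eq_iff[OF space] mult_defect_def)
  next
    case (2 b a)
    have "sym_defect m \<Delta> \<beta> a b = 0" if "bilinear_form s s \<beta>" for \<beta>
      using * that by blast
    then show ?case
      by (auto simp: tensor_class_eq_iff sym_defect_def)
  qed
qed

context Hopf_bimodule_algebra_coalgebra
begin

abbreviation (input) scaleE where "scaleE \<equiv> module_prod.scale scaleA scaleH"
abbreviation (input) multE where "multE \<equiv> biproduct_mult (\<cdot>\<^sub>H) (\<cdot>) (\<rhd>) (\<lhd>)"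
abbreviation (input) comultE where "comultE \<equiv> biproduct_comult scaleH \<Delta>\<^sub>H scaleA \<Delta>\<^sub>A \<phi> \<psi>"

sublocale E: vector_space_prod scaleA scaleH
  by unfold_locales

section \<open>The algebra E\<close>

lemmas bilinear_simps =
  bilinear_map_simps[OF H.mult_bilinear] bilinear_map_simps[OF A.mult_bilinear]
  bilinear_map_simps[OF lact_bilinear] bilinear_map_simps[OF ract_bilinear]

lemma biproduct_vector_space: "vector_space scaleE"
  by (rule E.p.vector_space_axioms)

lemma biproduct_mult_bilinear: "bilinear_map scaleE scaleE scaleE multE"
  unfolding bilinear_map_def Vector_Spaces.linear_iff
  by (auto simp: biproduct_vector_space bilinear_simps E.scale_prod algebra_simps)

lemma biproduct_algebra: "alternative_algebra scaleE multE"
proof -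
  have "multE (multE p q) r - multE p (multE q r) + multE (multE q p) r - multE q (multE p r) = 0"
    (is "?D = 0") for p q r
  proof (cases p; cases q; cases r)
    fix a x b y c z assume [simp]: "p = (a, x)" "q = (b, y)" "r = (c, z)"
    \<comment> \<open>The A-component is regrouped into instances of the axioms. The law is
      symmetric in \<open>p\<close> and \<open>q\<close>, which is why
      \<open>bimodule_algebra1\<close> and \<open>bimodule2\<close> appear twice;
      \<open>bimodule2\<close> is subtracted because it is stated with the opposite sign.\<close>
    have "?D =
      (((a \<cdot> b) \<cdot> c - a \<cdot> (b \<cdot> c) + (b \<cdot> a) \<cdot> c - b \<cdot> (a \<cdot> c)) +
       ((a \<lhd> y) \<cdot> c - a \<cdot> (y \<rhd> c) + (y \<rhd> a) \<cdot> c - y \<rhd> (a \<cdot> c)) +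
       ((b \<lhd> x) \<cdot> c - b \<cdot> (x \<rhd> c) + (x \<rhd> b) \<cdot> c - x \<rhd> (b \<cdot> c)) +
       ((a \<cdot> b) \<lhd> z - a \<cdot> (b \<lhd> z) + (b \<cdot> a) \<lhd> z - b \<cdot> (a \<lhd> z)) +
       ((x \<cdot>\<^sub>H y) \<rhd> c - x \<rhd> (y \<rhd> c) + (y \<cdot>\<^sub>H x) \<rhd> c - y \<rhd> (x \<rhd> c)) -
       (a \<lhd> (y \<cdot>\<^sub>H z) - (a \<lhd> y) \<lhd> z + y \<rhd> (a \<lhd> z) - (y \<rhd> a) \<lhd> z) -
       (b \<lhd> (x \<cdot>\<^sub>H z) - (b \<lhd> x) \<lhd> z + x \<rhd> (b \<lhd> z) - (x \<rhd> b) \<lhd> z),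
       (x \<cdot>\<^sub>H y) \<cdot>\<^sub>H z - x \<cdot>\<^sub>H (y \<cdot>\<^sub>H z) + (y \<cdot>\<^sub>H x) \<cdot>\<^sub>H z - y \<cdot>\<^sub>H (x \<cdot>\<^sub>H z))"
      by (simp add: bilinear_simps algebra_simps)
    then show "?D = 0"
      by (simp only: A.left_alternative H.left_alternative bimodule_algebra1 bimodule_algebra2
          bimodule1 bimodule2 add_0 diff_0_right zero_prod_def)
  qed
  moreover
  have "multE (multE p q) r - multE p (multE q r) + multE (multE p r) q - multE p (multE r q) = 0"
    (is "?D = 0") for p q r
  proof (cases p; cases q; cases r)
    fix a x b y c z assume [simp]: "p = (a, x)" "q = (b, y)" "r = (c, z)"
    \<comment> \<open>Now the symmetry is between \<open>q\<close> and \<open>r\<close>, and it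
      doubles \<open>bimodule_algebra4\<close> and \<open>bimodule3\<close>.\<close>
    have "?D =
      (((a \<cdot> b) \<cdot> c - a \<cdot> (b \<cdot> c) + (a \<cdot> c) \<cdot> b - a \<cdot> (c \<cdot> b)) +
       ((x \<rhd> b) \<cdot> c - x \<rhd> (b \<cdot> c) + (x \<rhd> c) \<cdot> b - x \<rhd> (c \<cdot> b)) +
       ((a \<lhd> y) \<cdot> c - a \<cdot> (y \<rhd> c) + (a \<cdot> c) \<lhd> y - a \<cdot> (c \<lhd> y)) +
       ((a \<lhd> z) \<cdot> b - a \<cdot> (z \<rhd> b) + (a \<cdot> b) \<lhd> z - a \<cdot> (b \<lhd> z)) +
       ((x \<cdot>\<^sub>H y) \<rhd> c - x \<rhd> (y \<rhd> c) + (x \<rhd> c) \<lhd> y - x \<rhd> (c \<lhd> y)) +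
       ((x \<cdot>\<^sub>H z) \<rhd> b - x \<rhd> (z \<rhd> b) + (x \<rhd> b) \<lhd> z - x \<rhd> (b \<lhd> z)) +
       ((a \<lhd> y) \<lhd> z - a \<lhd> (y \<cdot>\<^sub>H z) + (a \<lhd> z) \<lhd> y - a \<lhd> (z \<cdot>\<^sub>H y)),
       (x \<cdot>\<^sub>H y) \<cdot>\<^sub>H z - x \<cdot>\<^sub>H (y \<cdot>\<^sub>H z) + (x \<cdot>\<^sub>H z) \<cdot>\<^sub>H y - x \<cdot>\<^sub>H (z \<cdot>\<^sub>H y))"
      by (simp add: bilinear_simps algebra_simps)
    then show "?D = 0"
      by (simp only: A.right_alternative H.right_alternative bimodule_algebra3 bimodule_algebra4
          bimodule3 bimodule4 add_0 zero_prod_def)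
  qed
  ultimately show ?thesis
    by (intro alternative_algebra.intro alternative_algebra_axioms.intro biproduct_vector_space
        biproduct_mult_bilinear)
qed

section \<open>The coalgebra E\<close>

lemma linear_inclusions:
  shows linear_inl: "Vector_Spaces.linear scaleA scaleE (\<lambda>a. (a, 0))"
    and linear_inr: "Vector_Spaces.linear scaleH scaleE (\<lambda>x. (0, x))"
  by (auto simp: Vector_Spaces.linear_iff biproduct_vector_space V.vector_space_axioms
      H.vector_space_axioms E.scale_prod)

lemma sw_form_biproduct:
  assumes "bilinear_form scaleE scaleE \<beta>"
  shows "sw_form (comultE (a, x)) \<beta> =
    sw_form (\<Delta>\<^sub>A a) (\<lambda>u v. \<beta> (u, 0) (v, 0)) + sw_form (\<phi> a) (\<lambda>u v. \<beta> (0, u) (v, 0)) +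
    sw_form (\<psi> a) (\<lambda>u v. \<beta> (u, 0) (0, v)) + sw_form (\<Delta>\<^sub>H x) (\<lambda>u v. \<beta> (0, u) (0, v))"
  by (simp add: sw_form_tensor_class[OF assms])

lemma linear_form_biproduct_terms:
  assumes "bilinear_form scaleE scaleE \<beta>"
  shows "linear_form scaleA (\<lambda>a. sw_form (\<Delta>\<^sub>A a) (\<lambda>u v. \<beta> (u, 0) (v, 0)))"
    "linear_form scaleA (\<lambda>a. sw_form (\<phi> a) (\<lambda>u v. \<beta> (0, u) (v, 0)))"
    "linear_form scaleA (\<lambda>a. sw_form (\<psi> a) (\<lambda>u v. \<beta> (u, 0) (0, v)))"
    "linear_form scaleH (\<lambda>x. sw_form (\<Delta>\<^sub>H x) (\<lambda>u v. \<beta> (0, u) (0, v)))"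
  using bilinear_form_compose[OF assms linear_inl linear_inl]
    bilinear_form_compose[OF assms linear_inr linear_inl]
    bilinear_form_compose[OF assms linear_inl linear_inr]
    bilinear_form_compose[OF assms linear_inr linear_inr]
  by (simp_all add: linear_form_sw[OF A.comult_linear] linear_form_sw[OF lcoact_linear]
      linear_form_sw[OF rcoact_linear] linear_form_sw[OF H.comult_linear])

text \<open>The coset \<open>\<Delta>\<^sub>H 0\<close> is the null space, whose chosen
  representative need not be the formal sum 0. Its value under a form vanishes by linearity of the
  coproduct, and likewise for the maps on A.\<close>

lemma sw_form_biproduct_inclusions:
  assumes "bilinear_form scaleE scaleE \<beta>"
  shows "sw_form (comultE (a, 0)) \<beta> =
    sw_form (\<Delta>\<^sub>A a) (\<lambda>u v. \<beta> (u, 0) (v, 0)) + sw_form (\<phi> a) (\<lambda>u v. \<beta> (0, u) (v, 0)) +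
    sw_form (\<psi> a) (\<lambda>u v. \<beta> (u, 0) (0, v))"
    "sw_form (comultE (0, x)) \<beta> = sw_form (\<Delta>\<^sub>H x) (\<lambda>u v. \<beta> (0, u) (0, v))"
  \<comment> \<open>Unfolding \<open>biproduct_comult\<close> would destroy the left side of
    \<open>sw_form_biproduct\<close>, here and below.\<close>
  by (simp_all add: sw_form_biproduct[OF assms]
      linear_form_biproduct_terms[OF assms, THEN linear_form_zero] del: biproduct_comult.simps)

lemma biproduct_comult_linear: "linear_to_tensor scaleE scaleE scaleE comultE"
  unfolding linear_to_tensor_iff
proof (intro conjI allI impI)
  show "comultE p \<in> tensor_space scaleE scaleE" for p
    by (cases p) (simp add: tensor_space_def)
  fix \<beta> assume \<beta>: "bilinear_form scaleE scaleE \<beta>"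
  note terms = linear_form_biproduct_terms[OF \<beta>]
  show "linear_form scaleE (\<lambda>p. sw_form (comultE p) \<beta>)"
    unfolding linear_form_def
    by (auto simp: sw_form_biproduct[OF \<beta>] E.scale_prod terms[THEN linear_form_add]
        terms[THEN linear_form_scale] algebra_simps simp del: biproduct_comult.simps)
qed

text \<open>Two adjacent legs reveal their origin: HH comes from H, and AA, HA, AH come from A. So
  each of the eight blocks receives one term from each of the two iterated coproducts, and their
  difference is the coassociator or one of the F and D expressions.\<close>

lemma coassociator_biproduct:
  assumes \<gamma>: "trilinear_form scaleE scaleE scaleE \<gamma>"
  shows "formal_eval (\<lambda>(u, v, w). \<gamma> u v w) (coassociator comultE (a, x)) =
    formal_eval (\<lambda>(u, v, w). \<gamma> (u, 0) (v, 0) (w, 0)) (coassociator \<Delta>\<^sub>A a) +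
    formal_eval (\<lambda>(u, v, w). \<gamma> (0, u) (v, 0) (w, 0)) (bicomodule_F1 \<Delta>\<^sub>A \<phi> a) +
    formal_eval (\<lambda>(u, v, w). \<gamma> (u, 0) (0, v) (w, 0)) (bicomodule_F2 \<Delta>\<^sub>A \<phi> \<psi> a) +
    formal_eval (\<lambda>(u, v, w). \<gamma> (u, 0) (v, 0) (0, w)) (bicomodule_F3 \<Delta>\<^sub>A \<psi> a) +
    formal_eval (\<lambda>(u, v, w). \<gamma> (0, u) (0, v) (w, 0)) (bicomodule_D1 \<Delta>\<^sub>H \<phi> a) +
    formal_eval (\<lambda>(u, v, w). \<gamma> (0, u) (v, 0) (0, w)) (bicomodule_D2 \<phi> \<psi> a) +
    formal_eval (\<lambda>(u, v, w). \<gamma> (u, 0) (0, v) (0, w)) (bicomodule_D3 \<Delta>\<^sub>H \<psi> a) +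
    formal_eval (\<lambda>(u, v, w). \<gamma> (0, u) (0, v) (0, w)) (coassociator \<Delta>\<^sub>H x)"
  \<comment> \<open>The outer coproduct is expanded against the inner sum, viewed as a bilinear
    form. The inner one then acts only on \<open>(u, 0)\<close> or \<open>(0, u)\<close>.\<close>
  by (simp add: coassociator_def bicomodule_F1_def bicomodule_F2_def bicomodule_F3_def
      bicomodule_D1_def bicomodule_D2_def bicomodule_D3_def
      sw_form_biproduct[OF bilinear_form_sw1[OF biproduct_comult_linear \<gamma>]]
      sw_form_biproduct[OF bilinear_form_sw2[OF biproduct_comult_linear \<gamma>]]
      sw_form_biproduct_inclusions[OF trilinear_form_bilinear12[OF \<gamma>]]
      sw_form_biproduct_inclusions[OF trilinear_form_bilinear23[OF \<gamma>]]
      algebra_simps del: biproduct_comult.simps)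

lemma biproduct_coalgebra: "alternative_coalgebra scaleE comultE"
proof -
  have "formal_eval (\<lambda>(u, v, w). \<gamma> u v w) (coassociator comultE p) =
      - formal_eval (\<lambda>(u, v, w). \<gamma> v u w) (coassociator comultE p)"
    if \<gamma>: "trilinear_form scaleE scaleE scaleE \<gamma>" for \<gamma> p
  proof (cases p)
    case (Pair a x)
    note \<gamma>' = trilinear_form_compose[OF \<gamma>] trilinear_form_compose[OF trilinear_form_flip12[OF \<gamma>]]
    \<comment> \<open>Swapping the first two legs exchanges HAA with AHA and HAH with AHH. One axiom
      governs each exchanged pair and is used twice, for the form and for its flip; the other four
      blocks are preserved.\<close>
    note eqs =
      tensor_class3_eqD[OF A.coalternative12 \<gamma>'(1)[OF linear_inl linear_inl linear_inl], of a]
      tensor_class3_eqD[OF bicomodule_coalgebra1 \<gamma>'(1)[OF linear_inr linear_inl linear_inl], of a]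
      tensor_class3_eqD[OF bicomodule_coalgebra1 \<gamma>'(2)[OF linear_inr linear_inl linear_inl], of a]
      tensor_class3_eqD[OF bicomodule_coalgebra2 \<gamma>'(1)[OF linear_inl linear_inl linear_inr], of a]
      tensor_class3_eqD[OF bicomodule1 \<gamma>'(1)[OF linear_inr linear_inr linear_inl], of a]
      tensor_class3_eqD[OF bicomodule2 \<gamma>'(1)[OF linear_inl linear_inr linear_inr], of a]
      tensor_class3_eqD[OF bicomodule2 \<gamma>'(2)[OF linear_inl linear_inr linear_inr], of a]
      tensor_class3_eqD[OF H.coalternative12 \<gamma>'(1)[OF linear_inr linear_inr linear_inr], of x]
    from eqs show ?thesis
      by (simp add: Pair coassociator_biproduct[OF \<gamma>]
          coassociator_biproduct[OF trilinear_form_flip12[OF \<gamma>]])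
  qed
  moreover have "formal_eval (\<lambda>(u, v, w). \<gamma> u v w) (coassociator comultE p) =
      - formal_eval (\<lambda>(u, v, w). \<gamma> u w v) (coassociator comultE p)"
    if \<gamma>: "trilinear_form scaleE scaleE scaleE \<gamma>" for \<gamma> p
  proof (cases p)
    case (Pair a x)
    note \<gamma>' = trilinear_form_compose[OF \<gamma>] trilinear_form_compose[OF trilinear_form_flip23[OF \<gamma>]]
    \<comment> \<open>Swapping the last two legs exchanges AHA with AAH and HHA with HAH
      instead.\<close>
    note eqs =
      tensor_class3_eqD[OF A.coalternative23 \<gamma>'(1)[OF linear_inl linear_inl linear_inl], of a]
      tensor_class3_eqD[OF bicomodule_coalgebra3 \<gamma>'(1)[OF linear_inr linear_inl linear_inl], of a]
      tensor_class3_eqD[OF bicomodule_coalgebra4 \<gamma>'(1)[OF linear_inl linear_inl linear_inr], of a]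
      tensor_class3_eqD[OF bicomodule_coalgebra4 \<gamma>'(2)[OF linear_inl linear_inl linear_inr], of a]
      tensor_class3_eqD[OF bicomodule3 \<gamma>'(1)[OF linear_inr linear_inr linear_inl], of a]
      tensor_class3_eqD[OF bicomodule3 \<gamma>'(2)[OF linear_inr linear_inr linear_inl], of a]
      tensor_class3_eqD[OF bicomodule4 \<gamma>'(1)[OF linear_inl linear_inr linear_inr], of a]
      tensor_class3_eqD[OF H.coalternative23 \<gamma>'(1)[OF linear_inr linear_inr linear_inr], of x]
    from eqs show ?thesis
      by (simp add: Pair coassociator_biproduct[OF \<gamma>]
          coassociator_biproduct[OF trilinear_form_flip23[OF \<gamma>]])
  qed
  ultimately show ?thesis
    by (intro alternative_coalgebra.intro alternative_coalgebra_axioms.intro biproduct_vector_space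
        biproduct_comult_linear) (auto simp: tensor_class3_eq_iff)
qed

section \<open>The compatibility axioms of E and the braiding\<close>

definition mult_braiding :: "('a \<Rightarrow> 'a \<Rightarrow> 'k) \<Rightarrow> 'a \<Rightarrow> 'a \<Rightarrow> 'k" where
  "mult_braiding \<beta> a b =
     sw_form (\<phi> a) (\<lambda>am1 a0. \<beta> (am1 \<rhd> b) a0) + sw_form (\<psi> a) (\<lambda>a0 a1. \<beta> (a1 \<rhd> b) a0)
     - sw_form (\<phi> a) (\<lambda>am1 a0. \<beta> a0 (b \<lhd> am1)) + sw_form (\<psi> b) (\<lambda>b0 b1. \<beta> b0 (a \<lhd> b1))
     + sw_form (\<psi> b) (\<lambda>b0 b1. \<beta> b0 (b1 \<rhd> a)) - sw_form (\<phi> b) (\<lambda>bm1 b0. \<beta> (a \<lhd> bm1) b0)"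

text \<open>Each of the four terms on the right of the symmetrized axiom of E yields one summand
  here, and each of the six terms of the other axiom yields one of \<open>mult_braiding\<close>: the
  leg in H is the one that gets multiplied, so that it acts on the other argument.\<close>

definition sym_braiding :: "('a \<Rightarrow> 'a \<Rightarrow> 'k) \<Rightarrow> 'a \<Rightarrow> 'a \<Rightarrow> 'k" where
  "sym_braiding \<beta> a b =
     sw_form (\<psi> a) (\<lambda>a0 a1. \<beta> a0 (b \<lhd> a1)) + sw_form (\<psi> a) (\<lambda>a0 a1. \<beta> (b \<lhd> a1) a0)
     + sw_form (\<phi> b) (\<lambda>bm1 b0. \<beta> b0 (bm1 \<rhd> a)) + sw_form (\<phi> b) (\<lambda>bm1 b0. \<beta> (bm1 \<rhd> a) b0)"

lemma biproduct_defects: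
  assumes \<beta>: "bilinear_form scaleE scaleE \<beta>"
  defines "\<beta>AA \<equiv> \<lambda>u v. \<beta> (u, 0) (v, 0)"
  shows "mult_defect multE comultE \<beta> (a, x) (b, y) =
      mult_defect (\<cdot>) \<Delta>\<^sub>A \<beta>AA a b - mult_braiding \<beta>AA a b"
    and "sym_defect multE comultE \<beta> (a, x) (b, y) =
      sym_defect (\<cdot>) \<Delta>\<^sub>A \<beta>AA a b - sym_braiding \<beta>AA a b"
proof -
  \<comment> \<open>Separate names for the block forms keep \<open>split\<close> from rewriting its
    own right side again.\<close>
  define \<beta>AH where "\<beta>AH u v = \<beta> (u, 0) (0, v)" for u v
  define \<beta>HA where "\<beta>HA u v = \<beta> (0, u) (v, 0)" for u v
  define \<beta>HH where "\<beta>HH u v = \<beta> (0, u) (0, v)" for u v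
  have split: "\<beta> (c, z) (d, w) = \<beta>AA c d + \<beta>AH c w + \<beta>HA z d + \<beta>HH z w" for c z d w
    unfolding \<beta>AA_def \<beta>AH_def \<beta>HA_def \<beta>HH_def by (rule bilinear_form_split[OF \<beta>])
  have AA: "bilinear_form scaleA scaleA \<beta>AA"
    unfolding \<beta>AA_def by (rule bilinear_form_compose[OF \<beta> linear_inl linear_inl])
  have AH: "bilinear_form scaleA scaleH \<beta>AH"
    unfolding \<beta>AH_def[abs_def] by (rule bilinear_form_compose[OF \<beta> linear_inl linear_inr])
  have HA: "bilinear_form scaleH scaleA \<beta>HA"
    unfolding \<beta>HA_def[abs_def] by (rule bilinear_form_compose[OF \<beta> linear_inr linear_inl])
  have HH: "bilinear_form scaleH scaleH \<beta>HH"
    unfolding \<beta>HH_def[abs_def] by (rule bilinear_form_compose[OF \<beta> linear_inr linear_inr])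
  note flips = bilinear_form_flip[OF AA] bilinear_form_flip[OF AH] bilinear_form_flip[OF HA]
  note form_simps = bilinear_form_simps[OF AA] bilinear_form_simps[OF AH]
    bilinear_form_simps[OF HA] bilinear_form_simps[OF HH]
  \<comment> \<open>The A-component of a product in E is a sum of three elements, over which the
    coproduct and both coactions have to be distributed. The H-component is a single
    product.\<close>
  note add_simps = linear_form_sw[OF A.comult_linear AA, THEN linear_form_add]
    linear_form_sw[OF A.comult_linear flips(1), THEN linear_form_add]
    linear_form_sw[OF lcoact_linear HA, THEN linear_form_add]
    linear_form_sw[OF lcoact_linear flips(2), THEN linear_form_add]
    linear_form_sw[OF rcoact_linear AH, THEN linear_form_add]
    linear_form_sw[OF rcoact_linear flips(3), THEN linear_form_add]
  note comult_simps = sw_form_biproduct[OF \<beta>] sw_form_biproduct[OF bilinear_form_flip[OF \<beta>]]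
    bilinear_form_mult[OF \<beta> biproduct_mult_bilinear, THEN sw_form_biproduct]
  \<comment> \<open>Three summands of the product against three components of the coproduct on A
    make nine cases. Eight have a rule here; the ninth,
    \<open>\<Delta>\<^sub>A (a \<cdot> b)\<close>, survives as the defect of A. The last rule is for
    H.\<close>
  note mult_eqs =
    sw_form_eqD[OF bimodule_coalgebra1 AA] sw_form_eqD[OF bimodule_coalgebra2 AA]
    sw_form_eqD[OF bicomodule_algebra1 HA] sw_form_eqD[OF bicomodule_algebra2 AH]
    sw_form_eqD[OF HM1 HA] sw_form_eqD[OF HM2 AH] sw_form_eqD[OF HM3 AH] sw_form_eqD[OF HM4 HA]
    sw_form_eqD[OF H.comult_mult HH]
  \<comment> \<open>Products in A have a symmetrized axiom for each order of the coactions. For the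
    actions only \<open>\<phi>\<close> plus flipped \<open>\<psi>\<close> is given, so HM5 and HM6
    are applied both to the HA form and to the flipped AH form.\<close>
  note sym_eqs =
    sw_form_add_flip_eqD[OF bimodule_coalgebra3 AA] sw_form_add_flip_eqD[OF bimodule_coalgebra4 AA]
    sw_form_add_flip_eqD[OF bicomodule_algebra3 HA] sw_form_add_flip_eqD[OF bicomodule_algebra4 AH]
    sw_form_add_flip_eqD[OF HM5 HA] sw_form_add_flip_eqD[OF HM6 HA] sw_form_add_flip_eqD[OF HM5 flips(2)]
    sw_form_add_flip_eqD[OF HM6 flips(2)] sw_form_add_flip_eqD[OF H.comult_mult_sym HH]
  show "mult_defect multE comultE \<beta> (a, x) (b, y) =
      mult_defect (\<cdot>) \<Delta>\<^sub>A \<beta>AA a b - mult_braiding \<beta>AA a b"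
    by (simp add: mult_defect_def mult_braiding_def comult_simps split form_simps bilinear_simps
        add_simps mult_eqs algebra_simps
        del: biproduct_comult.simps)
  show "sym_defect multE comultE \<beta> (a, x) (b, y) =
      sym_defect (\<cdot>) \<Delta>\<^sub>A \<beta>AA a b - sym_braiding \<beta>AA a b"
    by (simp add: sym_defect_def sym_braiding_def comult_simps split form_simps bilinear_simps
        add_simps sym_eqs algebra_simps
        del: biproduct_comult.simps)
qed

lemma braided_iff_defects:
  "braided_alternative_bialgebra scaleH (\<cdot>\<^sub>H) \<Delta>\<^sub>H scaleA (\<cdot>) \<Delta>\<^sub>A (\<rhd>) (\<lhd>) \<phi> \<psi> \<longleftrightarrow>
    (\<forall>\<beta> a b. bilinear_form scaleA scaleA \<beta> \<longrightarrow>
      mult_defect (\<cdot>) \<Delta>\<^sub>A \<beta> a b = mult_braiding \<beta> a b \<and>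
      sym_defect (\<cdot>) \<Delta>\<^sub>A \<beta> a b = sym_braiding \<beta> a b)"
    (is "_ \<longleftrightarrow> ?R")
proof
  assume "braided_alternative_bialgebra scaleH (\<cdot>\<^sub>H) \<Delta>\<^sub>H scaleA (\<cdot>) \<Delta>\<^sub>A (\<rhd>) (\<lhd>) \<phi> \<psi>"
  then interpret braided: braided_alternative_bialgebra
    scaleH "(\<cdot>\<^sub>H)" \<Delta>\<^sub>H scaleA "(\<cdot>)" \<Delta>\<^sub>A "(\<rhd>)" "(\<lhd>)" \<phi> \<psi> .
  have "mult_defect (\<cdot>) \<Delta>\<^sub>A \<beta> a b = mult_braiding \<beta> a b"
    if "bilinear_form scaleA scaleA \<beta>" for \<beta> a b
    using sw_form_eqD[OF braided.BB1[of a b] that]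
    by (simp add: mult_defect_def mult_braiding_def)
  moreover have "sym_defect (\<cdot>) \<Delta>\<^sub>A \<beta> a b = sym_braiding \<beta> a b"
    if "bilinear_form scaleA scaleA \<beta>" for \<beta> a b
    using tensor_class_eqD[OF braided.BB2[of b a] that]
    by (simp add: sym_defect_def sym_braiding_def)
  ultimately show ?R
    by blast
next
  assume R: ?R
  have space: "\<Delta>\<^sub>A a \<in> tensor_space scaleA scaleA" for a
    using A.comult_linear by (simp add: linear_to_tensor_def)
  show "braided_alternative_bialgebra scaleH (\<cdot>\<^sub>H) \<Delta>\<^sub>H scaleA (\<cdot>) \<Delta>\<^sub>A (\<rhd>) (\<lhd>) \<phi> \<psi>"
  proof (intro braided_alternative_bialgebra.intro braided_alternative_bialgebra_axioms.intro
      Hopf_bimodule_algebra_coalgebra_axioms, goal_cases)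
    case (1 a b)
    have "mult_defect (\<cdot>) \<Delta>\<^sub>A \<beta> a b = mult_braiding \<beta> a b"
      if "bilinear_form scaleA scaleA \<beta>" for \<beta>
      using R that by blast
    then show ?case
      by (simp add: tensor_space_eq_iff[OF space] mult_defect_def mult_braiding_def algebra_simps)
  next
    case (2 b a)
    have "sym_defect (\<cdot>) \<Delta>\<^sub>A \<beta> a b = sym_braiding \<beta> a b"
      if "bilinear_form scaleA scaleA \<beta>" for \<beta>
      using R that by blast
    then show ?case
      by (simp add: tensor_class_eq_iff sym_defect_def sym_braiding_def algebra_simps)
  qed
qed

theorem biproduct_bialgebra_iff:
  "alternative_bialgebra scaleE multE comultE \<longleftrightarrow>
    braided_alternative_bialgebra scaleH (\<cdot>\<^sub>H) \<Delta>\<^sub>H scaleA (\<cdot>) \<Delta>\<^sub>A (\<rhd>) (\<lhd>) \<phi> \<psi>"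
  unfolding alternative_bialgebra_iff_defects[OF biproduct_algebra biproduct_coalgebra]
    braided_iff_defects
proof (intro iffI allI impI)
  fix \<beta> a b
  assume E: "\<forall>\<beta> p q. bilinear_form scaleE scaleE \<beta> \<longrightarrow>
      mult_defect multE comultE \<beta> p q = 0 \<and> sym_defect multE comultE \<beta> p q = 0"
    and \<beta>: "bilinear_form scaleA scaleA \<beta>"
  \<comment> \<open>Pulling back along the projection onto A extends the form by zero to the other
    blocks, so its AA restriction is the given form.\<close>
  have "bilinear_form scaleE scaleE (\<lambda>p q. \<beta> (fst p) (fst q))"
    using \<beta> by (simp add: bilinear_form_def linear_form_def E.scale_def)
  from E[rule_format, OF this, of "(a, 0)" "(b, 0)"] biproduct_defects[OF this, of a 0 b 0]
  show "mult_defect (\<cdot>) \<Delta>\<^sub>A \<beta> a b = mult_braiding \<beta> a b \<and>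
      sym_defect (\<cdot>) \<Delta>\<^sub>A \<beta> a b = sym_braiding \<beta> a b"
    by simp
next
  fix \<beta> p q
  assume A: "\<forall>\<beta> a b. bilinear_form scaleA scaleA \<beta> \<longrightarrow>
      mult_defect (\<cdot>) \<Delta>\<^sub>A \<beta> a b = mult_braiding \<beta> a b \<and>
      sym_defect (\<cdot>) \<Delta>\<^sub>A \<beta> a b = sym_braiding \<beta> a b"
    and \<beta>: "bilinear_form scaleE scaleE \<beta>"
  \<comment> \<open>By \<open>biproduct_defects\<close> the defects at \<open>p\<close> and
    \<open>q\<close> depend only on their A-components and on the AA block of the form, so the
    assumption at these data suffices.\<close>
  note AA = bilinear_form_compose[OF \<beta> linear_inl linear_inl]
  show "mult_defect multE comultE \<beta> p q = 0 \<and> sym_defect multE comultE \<beta> p q = 0"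
    using A[rule_format, OF AA, of "fst p" "fst q"]
      biproduct_defects[OF \<beta>, of "fst p" "snd p" "fst q" "snd q"] by simp
qed

end

theorem theorem3p3:
  fixes scaleH :: "'k::field_char_0 \<Rightarrow> 'h::ab_group_add \<Rightarrow> 'h"
    and multH :: "'h \<Rightarrow> 'h \<Rightarrow> 'h"
    and comultH :: "'h \<Rightarrow> ('h \<times> 'h \<Rightarrow>\<^sub>0 'k) set"
    and scaleA :: "'k \<Rightarrow> 'a::ab_group_add \<Rightarrow> 'a"
    and multA :: "'a \<Rightarrow> 'a \<Rightarrow> 'a"
    and comultA :: "'a \<Rightarrow> ('a \<times> 'a \<Rightarrow>\<^sub>0 'k) set"
    and lact :: "'h \<Rightarrow> 'a \<Rightarrow> 'a"
    and ract :: "'a \<Rightarrow> 'h \<Rightarrow> 'a"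
    and \<phi> :: "'a \<Rightarrow> ('h \<times> 'a \<Rightarrow>\<^sub>0 'k) set"
    and \<psi> :: "'a \<Rightarrow> ('a \<times> 'h \<Rightarrow>\<^sub>0 'k) set"
  assumes "alternative_bialgebra scaleH multH comultH"
    and "Hopf_bimodule_algebra_coalgebra
           scaleH multH comultH scaleA multA comultA lact ract \<phi> \<psi>"
  shows "alternative_bialgebra
           (module_prod.scale scaleA scaleH)
           (biproduct_mult multH multA lact ract)
           (biproduct_comult scaleH comultH scaleA comultA \<phi> \<psi>)
         \<longleftrightarrow>
         braided_alternative_bialgebra
           scaleH multH comultH scaleA multA comultA lact ract \<phi> \<psi>"
  using assms(2) by (rule Hopf_bimodule_algebra_coalgebra.biproduct_bialgebra_iff)

end
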